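(* Let $G$ be a non-locally cyclic group of order $n$ with $|Cyc(G)|=1$. Then: (i) $\gamma(\Gamma_G)+\gamma(\overline{\Gamma}_G)=n$ if and only if $G$ is an elementary Abelian $2$-group. (ii) $\gamma(\Gamma_G)+\gamma(\overline{\Gamma}_G)=n-1$ if and only if $G\cong S_3$. (iii) $\gamma(\Gamma_G)+\gamma(\overline{\Gamma}_G)=n-2$ if and only if $G\cong D_8$. (iv) $\gamma(\Gamma_G)+\gamma(\overline{\Gamma}_G)=n-3$ if and only if either $G\cong D_{10}$ or $G\cong \mathbb{Z}_3\oplus \mathbb{Z}_3$.
   Context: A group is locally cyclic if every finitely generated subgroup is cyclic (so a finite group is non-locally cyclic iff it is not cyclic). For a group $G$, the cyclicizer is $Cyc(G)=\{y\in G \mid \langle x,y\rangle \text{ is cyclic for all } x\in G\}$. For a non-locally cyclic finite group $G$, the non-cyclic graph $\Gamma_G$ is the simple graph with vertex set $G\setminus Cyc(G)$ in which two distinct vertices $x,y$ are adjacent if and only if $\langle x,y\rangle$ is not cyclic; $\overline{\Gamma}_G$ is its complement (same vertex set, distinct $x,y$ adjacent iff $\langle x,y\rangle$ is cyclic). For a graph $\Gamma$, a dominating set is a set $D$ of vertices such that every vertex not in $D$ is adjacent to at least one vertex of $D$; the domination number $\gamma(\Gamma)$ is the smallest cardinality of a dominating set. $D_{2m}$ denotes the dihedral group of order $2m$, and $S_3$ the symmetric group on three letters. *)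

theory Defs
  imports "HOL-Algebra.Algebra" "Graph_Theory.Pair_Digraph"
begin

definition locally_cyclic :: "('a, 'b) monoid_scheme \<Rightarrow> bool" where
  "locally_cyclic G \<longleftrightarrow>
     (\<forall>S. finite S \<and> S \<subseteq> carrier G \<longrightarrow> cyclic_group (subgroup_generated G S))"

definition cyclicizer :: "('a, 'b) monoid_scheme \<Rightarrow> 'a set" where
  "cyclicizer G =
     {y \<in> carrier G. \<forall>x \<in> carrier G. cyclic_group (subgroup_generated G {x, y})}"

text \<open>
  A simple graph is a pair digraph whose arc set is symmetric and irreflexive: an edge
  between \<open>x\<close> and \<open>y\<close> is represented by the two arcs \<open>(x, y)\<close> and \<open>(y, x)\<close>.
\<close>

definition noncyclic_graph :: "('a, 'b) monoid_scheme \<Rightarrow> 'a pair_pre_digraph" where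
  "noncyclic_graph G =
     \<lparr> pverts = carrier G - cyclicizer G,
       parcs = {(x, y). x \<in> carrier G - cyclicizer G \<and> y \<in> carrier G - cyclicizer G \<and>
                  x \<noteq> y \<and> \<not> cyclic_group (subgroup_generated G {x, y})} \<rparr>"

definition graph_complement :: "'a pair_pre_digraph \<Rightarrow> 'a pair_pre_digraph" where
  "graph_complement \<Gamma> =
     \<lparr> pverts = pverts \<Gamma>,
       parcs = {(x, y). x \<in> pverts \<Gamma> \<and> y \<in> pverts \<Gamma> \<and> x \<noteq> y \<and> (x, y) \<notin> parcs \<Gamma>} \<rparr>"

definition dominating_set :: "'a pair_pre_digraph \<Rightarrow> 'a set \<Rightarrow> bool" where
  "dominating_set \<Gamma> D \<longleftrightarrow>
     D \<subseteq> pverts \<Gamma> \<and> (\<forall>v \<in> pverts \<Gamma> - D. \<exists>d \<in> D. (v, d) \<in> parcs \<Gamma>)"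

text \<open>
  The minimum exists whenever the graph has a finite dominating set, in particular for
  every finite graph; requiring \<open>finite D\<close> discards the junk value \<open>card D = 0\<close> for infinite \<open>D\<close>.
\<close>

definition domination_number :: "'a pair_pre_digraph \<Rightarrow> nat" where
  "domination_number \<Gamma> = (LEAST k. \<exists>D. finite D \<and> dominating_set \<Gamma> D \<and> card D = k)"

definition elementary_abelian_group :: "nat \<Rightarrow> ('a, 'b) monoid_scheme \<Rightarrow> bool" where
  "elementary_abelian_group p G \<longleftrightarrow>
     Factorial_Ring.prime p \<and> comm_group G \<and> (\<forall>x \<in> carrier G - {\<one>\<^bsub>G\<^esub>}. group.ord G x = p)"

text \<open>
  The dihedral group of order \<open>2 * m\<close> (for \<open>m > 0\<close>): the pair \<open>(a, s)\<close> stands for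
  \<open>r\<^sup>a\<close> if \<open>s\<close> is false and for \<open>r\<^sup>a f\<close> if \<open>s\<close> is true, where \<open>r\<close> is the rotation of
  order \<open>m\<close>, \<open>f\<close> a reflection, and \<open>f r\<^sup>b = r\<^sup>-\<^sup>b f\<close>.
\<close>

definition dihedral_group :: "nat \<Rightarrow> (int \<times> bool) monoid" where
  "dihedral_group m =
     \<lparr> carrier = {0..<int m} \<times> UNIV,
       monoid.mult = (\<lambda>(a, s) (b, t). ((if s then a - b else a + b) mod int m, s \<noteq> t)),
       one = (0, False) \<rparr>"

lemma order_dihedral_group: "order (dihedral_group m) = 2 * m"
  by (simp add: order_def dihedral_group_def card_cartesian_product)

lemma group_dihedral_group:
  assumes "m > 0"
  shows "group (dihedral_group m)"
proof (rule groupI, goal_cases)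
  case (3 x y z)
  then show ?case
    by (auto simp: dihedral_group_def split: prod.splits; simp add: mod_simps algebra_simps)
next
  case (5 x)
  obtain a s where x: "x = (a, s)" by (cases x)
  let ?y = "(if s then a else (- a) mod int m, s)"
  have "?y \<in> carrier (dihedral_group m)"
    using 5 assms x by (auto simp: dihedral_group_def)
  moreover have "?y \<otimes>\<^bsub>dihedral_group m\<^esub> x = \<one>\<^bsub>dihedral_group m\<^esub>"
    using x by (auto simp: dihedral_group_def mod_simps)
  ultimately show ?case by blast
qed (use assms in \<open>auto simp: dihedral_group_def\<close>)

lemma pair_graph_noncyclic_graph:
  assumes "finite (carrier G)"
  shows "pair_graph (noncyclic_graph G)"
proof
  show "finite (parcs (noncyclic_graph G))"
    by (rule finite_subset[of _ "carrier G \<times> carrier G"])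
       (use assms in \<open>auto simp: noncyclic_graph_def\<close>)
qed (use assms in \<open>auto simp: noncyclic_graph_def symmetric_def sym_def insert_commute\<close>)

lemma pair_graph_graph_complement:
  assumes "pair_graph \<Gamma>"
  shows "pair_graph (graph_complement \<Gamma>)"
proof -
  interpret pair_graph \<Gamma> by fact
  have sym: "(x, y) \<in> parcs \<Gamma> \<longleftrightarrow> (y, x) \<in> parcs \<Gamma>" for x y
    using arcs_symmetric by blast
  show ?thesis
  proof
    show "finite (parcs (graph_complement \<Gamma>))"
      by (rule finite_subset[of _ "pverts \<Gamma> \<times> pverts \<Gamma>"]) (auto simp: graph_complement_def)
  qed (use sym in \<open>auto simp: graph_complement_def symmetric_def sym_def\<close>)
qed

end

theory Submission
  imports Defs
begin

text \<open>
  Write \<open>V\<close> for the set of non-identity elements, the common vertex set of both graphs, and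
  \<open>\<gamma>\<close>, \<open>\<gamma>'\<close> for the domination numbers of the non-cyclic graph and of its complement. Two
  elements are adjacent in the complement iff some cyclic subgroup contains both of them. The
  theorem asks when the defect \<open>n - (\<gamma> + \<gamma>')\<close> is at most three, and two estimates
  control this defect.

  A set of \<open>k\<close> vertices that is dominated, in the complement, from outside itself can be left out
  of a dominating set, so that \<open>\<gamma>' \<le> n - 1 - k\<close>; such savings made in disjoint parts of the
  group add up. An element \<open>x\<close> of order \<open>k\<close> saves the other \<open>k - 2\<close> non-identity elements of
  its cyclic subgroup, every pair \<open>{x, inv x}\<close> with \<open>inv x \<noteq> x\<close> saves one, and two distinct
  subgroups of order three already save four, because they force two further such subgroups
  (\<open>spares_ord_3\<close>). On the other side, if \<open>x\<close> generates a maximal cyclic subgroup, then \<open>x\<close>,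
  together with one element for each prime divisor of its order, dominates the non-cyclic
  graph, so \<open>\<gamma>\<close> exceeds the number of these primes by at most one; and \<open>\<gamma> = 1\<close> if \<open>x\<close> is an
  involution (\<open>\<gamma>_le_maximal\<close>, \<open>maximal_involution_isolated\<close>). If the defect is at most three,
  every saving is at most \<open>\<gamma> + 2\<close>.

  If \<open>\<gamma> = 1\<close>, no saving exceeds three. Then all orders are at most five, and outside the cyclic
  subgroup of an element \<open>c\<close> of largest order there are only involutions, since otherwise a
  fourth saving appears (\<open>rotation_if_spares_le_3\<close>). Such a group has exponent two or is
  dihedral with \<open>c\<close> as rotation of order 3, 4 or 5.

  If \<open>\<gamma> \<ge> 2\<close>, no maximal cyclic subgroup has order two. As a group is never the union of two
  proper subgroups, there are at least three maximal cyclic subgroups; the savings that they make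
  bound the order of each by its number of prime divisors plus three, hence by four. Elements
  of order four are ruled out by counting further, so the group has exponent three, at most
  nine elements, and is \<open>\<int>\<^sub>3 \<oplus> \<int>\<^sub>3\<close> (\<open>iso_Z3_Z3_if_spares_le\<close>).

  Conversely, the two domination numbers of each group in the list can be computed exactly. The
  defects are 0, 1, 2, 3, 3, so that the value of the defect separates the cases.
\<close>

section \<open>Cyclic subgroups of a finite group\<close>

text \<open>
  Subgroups of cyclic groups are cyclic; for two generators this is Bezout's identity. The
  criterion replaces the generated subgroup by mere membership in a common cyclic subgroup.
\<close>

lemma (in group) cyclic_pair_iff:
  assumes "x \<in> carrier G" "y \<in> carrier G"
  shows "cyclic_group (subgroup_generated G {x, y}) \<longleftrightarrow>
    (\<exists>g\<in>carrier G. x \<in> generate G {g} \<and> y \<in> generate G {g})"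
proof
  let ?H = "subgroup_generated G {x, y}"
  interpret H: group ?H by simp
  assume "cyclic_group ?H"
  then obtain h where h: "h \<in> carrier ?H" "carrier ?H = range (\<lambda>n::int. h [^]\<^bsub>?H\<^esub> n)"
    using H.cyclic_group by blast
  have hG: "h \<in> carrier G" using h(1) carrier_subgroup_generated_subset by blast
  have "h [^]\<^bsub>?H\<^esub> n = h [^] n" for n :: int
    by (rule int_pow_subgroup_generated[OF h(1)])
  then have "carrier ?H = generate G {h}"
    unfolding h(2) generate_pow[OF hG] by auto
  moreover have "x \<in> carrier ?H" "y \<in> carrier ?H"
    using assms by (auto simp: carrier_subgroup_generated intro: generate.incl)
  ultimately show "\<exists>g\<in>carrier G. x \<in> generate G {g} \<and> y \<in> generate G {g}"
    using hG by auto
next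
  assume "\<exists>g\<in>carrier G. x \<in> generate G {g} \<and> y \<in> generate G {g}"
  then obtain g i j where g: "g \<in> carrier G" "x = g [^] (i::int)" "y = g [^] (j::int)"
    by (auto simp: generate_pow)
  \<comment> \<open>By Bezout the power of \<open>g\<close> with exponent \<open>gcd i j\<close> generates the same subgroup.\<close>
  define h where "h = g [^] gcd i j"
  have hG: "h \<in> carrier G" by (simp add: h_def g)
  obtain u v where uv: "u * i + v * j = gcd i j" using bezout_int by blast
  have "h = x [^] u \<otimes> y [^] v"
    unfolding h_def g uv[symmetric] by (simp add: g int_pow_mult int_pow_pow mult.commute)
  moreover have sub: "subgroup (generate G {x, y}) G"
    using assms by (simp add: generate_is_subgroup)
  moreover have "x \<in> generate G {x, y}" "y \<in> generate G {x, y}"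
    by (auto intro: generate.incl)
  ultimately have hin: "h \<in> generate G {x, y}"
    by (simp add: subgroup_int_pow_closed subgroup.m_closed)
  have "x = h [^] (i div gcd i j)" "y = h [^] (j div gcd i j)"
    unfolding h_def g by (simp_all add: g int_pow_pow)
  then have xy: "x \<in> generate G {h}" "y \<in> generate G {h}"
    using hG by (auto simp: generate_pow)
  have "generate G {x, y} = generate G {h}"
    using generate_subgroup_incl[OF _ generate_is_subgroup[of "{h}"], of "{x, y}"]
      generate_subgroup_incl[OF _ sub, of "{h}"] hin hG xy by auto
  then have "subgroup_generated G {x, y} = subgroup_generated G {h}"
    using assms hG by (simp add: subgroup_generated_def)
  then show "cyclic_group (subgroup_generated G {x, y})"
    by (simp add: cyclic_group_generated)
qed

locale finite_group = group +
  assumes finite_carrier [simp, intro]: "finite (carrier G)"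
begin

abbreviation cyc :: "'a \<Rightarrow> 'a set" where
  "cyc x \<equiv> generate G {x}"

definition cocyclic :: "'a \<Rightarrow> 'a \<Rightarrow> bool" where
  "cocyclic x y \<longleftrightarrow> (\<exists>g\<in>carrier G. x \<in> cyc g \<and> y \<in> cyc g)"

definition maximal_cyclic :: "'a \<Rightarrow> bool" where
  "maximal_cyclic x \<longleftrightarrow> x \<in> carrier G \<and> (\<forall>g\<in>carrier G. x \<in> cyc g \<longrightarrow> g \<in> cyc x)"

lemma cyc_subgroup: "x \<in> carrier G \<Longrightarrow> subgroup (cyc x) G"
  by (simp add: generate_is_subgroup)

lemma cyc_self [simp]: "x \<in> cyc x"
  by (simp add: generate.incl)

lemma cyc_one [simp]: "\<one> \<in> cyc x"
  by (rule generate.one)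

lemma cyc_carrier: "x \<in> carrier G \<Longrightarrow> y \<in> cyc x \<Longrightarrow> y \<in> carrier G"
  using cyc_subgroup[of x] subgroup.mem_carrier by metis

lemma cyc_subset_carrier: "x \<in> carrier G \<Longrightarrow> cyc x \<subseteq> carrier G"
  using cyc_carrier by blast

lemma cyc_finite [simp]: "x \<in> carrier G \<Longrightarrow> finite (cyc x)"
  using cyc_subset_carrier finite_subset finite_carrier by metis

lemma cyc_mult: "x \<in> carrier G \<Longrightarrow> a \<in> cyc x \<Longrightarrow> b \<in> cyc x \<Longrightarrow> a \<otimes> b \<in> cyc x"
  by (rule generate.eng)

lemma cyc_inv: "x \<in> carrier G \<Longrightarrow> a \<in> cyc x \<Longrightarrow> inv a \<in> cyc x"
  using cyc_subgroup[of x] subgroup.m_inv_closed by metis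

lemma cyc_inv_iff:
  "x \<in> carrier G \<Longrightarrow> a \<in> carrier G \<Longrightarrow> inv a \<in> cyc x \<longleftrightarrow> a \<in> cyc x"
  using cyc_inv[of x a] cyc_inv[of x "inv a"] by auto

lemma cyc_mono: "x \<in> carrier G \<Longrightarrow> y \<in> cyc x \<Longrightarrow> cyc y \<subseteq> cyc x"
  using generate_subgroup_incl[OF _ cyc_subgroup, of "{y}" x] by simp

lemma cyc_int_pow: "x \<in> carrier G \<Longrightarrow> x [^] (k::int) \<in> cyc x"
  by (auto simp: generate_pow)

lemma cyc_nat_pow: "x \<in> carrier G \<Longrightarrow> x [^] (k::nat) \<in> cyc x"
  using cyc_int_pow[of x "int k"] by (simp add: int_pow_int)

lemma cyc_natE:
  assumes "y \<in> cyc x" "x \<in> carrier G"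
  obtains k :: nat where "k < ord x" "y = x [^] k"
proof -
  obtain j :: nat where j: "y = x [^] j"
    using assms by (auto simp: generate_pow_on_finite_carrier[OF finite_carrier])
  have pos: "ord x > 0" using ord_ge_1[OF finite_carrier assms(2)] by simp
  have "y = x [^] (j mod ord x)"
  proof -
    have "x [^] j = x [^] (ord x * (j div ord x) + j mod ord x)" by simp
    also have "\<dots> = x [^] (ord x * (j div ord x)) \<otimes> x [^] (j mod ord x)"
      using assms(2) by (rule nat_pow_mult[symmetric])
    also have "\<dots> = x [^] (j mod ord x)"
      using assms(2) by (simp flip: nat_pow_pow)
    finally show ?thesis using j by simp
  qed
  then show thesis using that[of "j mod ord x"] pos by auto
qed

lemma cyc_card: "x \<in> carrier G \<Longrightarrow> card (cyc x) = ord x"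
  by (simp add: generate_pow_card)

lemma ord_pos [simp]: "x \<in> carrier G \<Longrightarrow> ord x > 0"
  using ord_ge_1[OF finite_carrier] by force

lemma cyc_eq_if_ord_le:
  assumes "x \<in> carrier G" "y \<in> cyc x" "ord x \<le> ord y"
  shows "cyc y = cyc x"
proof (rule card_seteq)
  show "card (cyc x) \<le> card (cyc y)"
    using assms cyc_carrier[of x y] by (simp add: cyc_card)
qed (use assms cyc_mono in auto)

lemma ord_dvd_of_mem_cyc:
  assumes "x \<in> carrier G" "y \<in> cyc x"
  shows "ord y dvd ord x"
proof -
  obtain k :: nat where "y = x [^] k" using cyc_natE assms by metis
  then have "y [^] ord x = \<one>"
    using assms by (metis nat_pow_pow nat_pow_one mult.commute pow_ord_eq_1)
  then show ?thesis using assms cyc_carrier pow_eq_id by metis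
qed

text \<open>
  A subgroup of prime order is generated by each of its non-identity elements, so it either meets
  another subgroup trivially or lies inside it.
\<close>

lemma cyc_prime_inter:
  assumes "x \<in> carrier G" "y \<in> carrier G" "Factorial_Ring.prime (ord x)" "x \<notin> cyc y"
    "v \<in> cyc x" "v \<in> cyc y"
  shows "v = \<one>"
proof (rule ccontr)
  assume "v \<noteq> \<one>"
  moreover have v: "v \<in> carrier G" using assms cyc_carrier by blast
  ultimately have "ord v = ord x"
    using ord_dvd_of_mem_cyc[OF assms(1,5)] assms(3) ord_eq_1[OF v]
    by (auto simp: prime_nat_iff)
  then have "x \<in> cyc v" using cyc_eq_if_ord_le[OF assms(1,5)] by simp
  then show False using cyc_mono[OF assms(2,6)] assms(4) by blast
qed

lemma cocyclic_sym: "cocyclic x y \<Longrightarrow> cocyclic y x"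
  by (auto simp: cocyclic_def)

lemma cocyclic_mem: "x \<in> carrier G \<Longrightarrow> y \<in> cyc x \<Longrightarrow> cocyclic x y"
  unfolding cocyclic_def using cyc_self by blast

lemma cocyclic_cyc:
  assumes "cocyclic x y" "z \<in> cyc x"
  shows "cocyclic z y"
proof -
  obtain g where g: "g \<in> carrier G" "x \<in> cyc g" "y \<in> cyc g"
    using assms(1) cocyclic_def by blast
  then have "z \<in> cyc g" using cyc_mono[OF g(1,2)] assms(2) by blast
  then show ?thesis using g cocyclic_def by blast
qed

text \<open>
  In the complement graph, a generator of a maximal cyclic subgroup has no neighbours outside it.
\<close>

lemma maximal_cyclic_cocyclic:
  assumes "maximal_cyclic x" "cocyclic x y"
  shows "y \<in> cyc x"
proof -
  obtain g where g: "g \<in> carrier G" "x \<in> cyc g" "y \<in> cyc g"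
    using assms(2) cocyclic_def by blast
  then have "g \<in> cyc x" "x \<in> carrier G" using assms(1) unfolding maximal_cyclic_def by auto
  then show ?thesis using g(3) cyc_mono by blast
qed

lemma maximal_cyclic_above:
  assumes "y \<in> carrier G"
  obtains x where "maximal_cyclic x" "y \<in> cyc x"
proof -
  let ?S = "{g \<in> carrier G. y \<in> cyc g}"
  have fin: "finite ?S" and ne: "?S \<noteq> {}" using assms by auto
  obtain x where x: "x \<in> ?S" and "ord x = Max (ord ` ?S)"
    using Max_in[of "ord ` ?S"] fin ne by fastforce
  then have max: "ord g \<le> ord x" if "g \<in> ?S" for g
    using fin that by simp
  have "maximal_cyclic x"
    unfolding maximal_cyclic_def
  proof (intro conjI ballI impI)
    fix g assume g: "g \<in> carrier G" "x \<in> cyc g"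
    then have "y \<in> cyc g" using x cyc_mono by blast
    then have "cyc x = cyc g" using cyc_eq_if_ord_le g max by blast
    then show "g \<in> cyc x" by simp
  qed (use x in auto)
  then show thesis using that x by blast
qed

lemma cyclic_pair_cocyclic:
  "x \<in> carrier G \<Longrightarrow> y \<in> carrier G \<Longrightarrow>
    cyclic_group (subgroup_generated G {x, y}) \<longleftrightarrow> cocyclic x y"
  unfolding cocyclic_def by (rule cyclic_pair_iff)

text \<open>
  A cyclic group has only one subgroup of order \<open>p\<close>, and its standard generator is the power
  of \<open>x\<close> on the left. It lies in every subgroup of \<open>cyc x\<close> whose order is divisible by \<open>p\<close>.
\<close>

lemma prime_order_power_mem:
  assumes x: "x \<in> carrier G" and v: "v \<in> cyc x"
    and p: "Factorial_Ring.prime p" "p dvd ord v"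
  shows "x [^] (ord x div p) \<in> cyc v"
proof -
  have vG: "v \<in> carrier G" using x v cyc_carrier by blast
  have px: "p dvd ord x" using p(2) ord_dvd_of_mem_cyc[OF x v] by (rule dvd_trans)
  have p0: "p > 0" using p(1) prime_gt_0_nat by blast
  have ord_root: "ord (u [^] (ord u div p)) = p" if u: "u \<in> carrier G" "p dvd ord u" for u
  proof -
    obtain q where q: "ord u = p * q" using u(2) by blast
    have "q > 0" using q ord_pos[OF u(1)] by simp
    then show ?thesis using ord_pow[OF u(1), of q] q p0 by simp
  qed
  define w e where "w = v [^] (ord v div p)" and "e = x [^] (ord x div p)"
  have wv: "w \<in> cyc v" unfolding w_def by (rule cyc_nat_pow[OF vG])
  have eG: "e \<in> carrier G" using x by (simp add: e_def)
  have ords: "ord w = p" "ord e = p" unfolding w_def e_def using ord_root x vG px p(2) by auto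
  have "w \<in> cyc x" using wv cyc_mono[OF x v] by blast
  then obtain k :: nat where k: "w = x [^] k" using cyc_natE[OF _ x] by metis
  have "x [^] (k * p) = \<one>" using pow_ord_eq_1[of w] ords(1) k x by (metis nat_pow_closed nat_pow_pow)
  then have "ord x dvd k * p" using pow_eq_id[OF x] by simp
  \<comment> \<open>Solving \<open>w [^] p = \<one>\<close> inside \<open>cyc x\<close> shows that \<open>w\<close> is a power of \<open>e\<close>.\<close>
  then have "ord x div p dvd k" using px p0 by (simp add: div_dvd_iff_mult)
  then obtain i where "k = ord x div p * i" by blast
  then have "w = e [^] i" using k x by (simp add: e_def nat_pow_pow)
  then have "w \<in> cyc e" using cyc_nat_pow[OF eG] by simp
  then have "cyc w = cyc e" by (rule cyc_eq_if_ord_le[OF eG]) (unfold ords, rule order.refl)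
  then have "e \<in> cyc v" using cyc_mono[OF vG wv] cyc_self[of e] by blast
  then show ?thesis by (simp add: e_def)
qed

text \<open>
  The product \<open>x \<otimes> z\<close> witnesses that a group is not the union of two incomparable subgroups; a
  maximal cyclic subgroup above it gives the third generator.
\<close>

lemma third_maximal_cyclic:
  assumes xG: "x \<in> carrier G" and zG: "z \<in> carrier G" and xz: "x \<notin> cyc z" and zx: "z \<notin> cyc x"
  obtains w where "maximal_cyclic w" "w \<notin> cyc x" "w \<notin> cyc z"
proof -
  define b where "b = x \<otimes> z"
  have bG: "b \<in> carrier G" using xG zG by (simp add: b_def)
  have "z = inv x \<otimes> b" "x = b \<otimes> inv z"
    using xG zG by (simp_all add: b_def m_assoc inv_solve_left inv_solve_right)
  then have b: "b \<notin> cyc x" "b \<notin> cyc z"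
    using zx xz cyc_mult cyc_inv cyc_self xG zG by metis+
  obtain w where w: "maximal_cyclic w" "b \<in> cyc w" using maximal_cyclic_above bG by blast
  have "w \<notin> cyc x" "w \<notin> cyc z" using cyc_mono[OF xG] cyc_mono[OF zG] w(2) b by blast+
  then show thesis using that w by blast
qed

end

section \<open>Dominating sets of the non-cyclic graph and of its complement\<close>

lemma domination_number_le:
  "finite D \<Longrightarrow> dominating_set \<Gamma> D \<Longrightarrow> domination_number \<Gamma> \<le> card D"
  unfolding domination_number_def by (rule Least_le) blast

text \<open>
  The full vertex set is dominating, so for finite graphs the minimum is taken over a non-empty
  set and is attained.
\<close>

lemma domination_number_attained:
  assumes "finite (pverts \<Gamma>)"
  obtains D where "finite D" "dominating_set \<Gamma> D" "card D = domination_number \<Gamma>"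
proof -
  have "\<exists>D. finite D \<and> dominating_set \<Gamma> D \<and> card D = card (pverts \<Gamma>)"
    using assms by (auto simp: dominating_set_def)
  then have "\<exists>D. finite D \<and> dominating_set \<Gamma> D \<and> card D = domination_number \<Gamma>"
    unfolding domination_number_def by (rule LeastI)
  then show thesis using that by blast
qed

text \<open>
  A finite group with trivial cyclicizer is non-cyclic as soon as it has more than one element:
  in a cyclic group the cyclicizer is everything. The hypotheses of the theorem amount to this
  locale.
\<close>

locale trivial_cyclicizer_group = finite_group +
  assumes cyclicizer_trivial: "cyclicizer G = {\<one>}"
    and nontrivial: "carrier G \<noteq> {\<one>}"
begin

abbreviation V :: "'a set" where
  "V \<equiv> carrier G - {\<one>}"

abbreviation \<gamma> :: nat where
  "\<gamma> \<equiv> domination_number (noncyclic_graph G)"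

abbreviation \<gamma>' :: nat where
  "\<gamma>' \<equiv> domination_number (graph_complement (noncyclic_graph G))"

lemma card_V: "card V + 1 = order G"
  using card_Suc_Diff1[of "carrier G" \<one>] by (simp add: order_def)

lemma finite_subset_V: "D \<subseteq> V \<Longrightarrow> finite D"
  using finite_subset[of D V] by simp

lemma V_nonempty: "V \<noteq> {}"
  using nontrivial by auto

lemma exists_not_cocyclic:
  assumes "v \<in> V"
  obtains g where "g \<in> V" "\<not> cocyclic v g"
proof -
  have "v \<notin> cyclicizer G" using assms cyclicizer_trivial by simp
  then obtain g where g: "g \<in> carrier G" "\<not> cocyclic v g"
    using assms cocyclic_sym by (auto simp: cyclicizer_def cyclic_pair_cocyclic)
  moreover have "cocyclic v \<one>" using assms by (simp add: cocyclic_mem)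
  ultimately show thesis using that by blast
qed

lemma cyc_proper:
  assumes "x \<in> carrier G"
  obtains a where "a \<in> carrier G" "a \<notin> cyc x"
proof -
  obtain v where v: "v \<in> V" using V_nonempty by blast
  obtain g where g: "g \<in> V" "\<not> cocyclic v g" using exists_not_cocyclic v by blast
  have "\<not> (v \<in> cyc x \<and> g \<in> cyc x)" using g(2) assms unfolding cocyclic_def by blast
  then show thesis using that v g by blast
qed

lemma dominating_noncyclic_iff:
  "dominating_set (noncyclic_graph G) D \<longleftrightarrow>
    D \<subseteq> V \<and> (\<forall>v\<in>V - D. \<exists>d\<in>D. \<not> cocyclic v d)"
proof (cases "D \<subseteq> V")
  case True
  have pv: "pverts (noncyclic_graph G) = V"
    by (simp add: noncyclic_graph_def cyclicizer_trivial)
  have "(v, d) \<in> parcs (noncyclic_graph G) \<longleftrightarrow> \<not> cocyclic v d"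
    if "v \<in> V - D" "d \<in> D" for v d
  proof -
    have "v \<in> V" "d \<in> V" "v \<noteq> d" using True that by auto
    then show ?thesis
      unfolding noncyclic_graph_def cyclicizer_trivial
      by (simp add: cyclic_pair_cocyclic)
  qed
  then show ?thesis unfolding dominating_set_def pv by blast
next
  case False
  then show ?thesis
    by (simp add: dominating_set_def noncyclic_graph_def cyclicizer_trivial)
qed

lemma dominating_complement_iff:
  "dominating_set (graph_complement (noncyclic_graph G)) D \<longleftrightarrow>
    D \<subseteq> V \<and> (\<forall>v\<in>V - D. \<exists>d\<in>D. cocyclic v d)"
proof (cases "D \<subseteq> V")
  case True
  have pv: "pverts (graph_complement (noncyclic_graph G)) = V"
    by (simp add: noncyclic_graph_def graph_complement_def cyclicizer_trivial)
  have "(v, d) \<in> parcs (graph_complement (noncyclic_graph G)) \<longleftrightarrow> cocyclic v d"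
    if "v \<in> V - D" "d \<in> D" for v d
  proof -
    have "v \<in> V" "d \<in> V" "v \<noteq> d" using True that by auto
    then show ?thesis
      unfolding noncyclic_graph_def graph_complement_def cyclicizer_trivial
      by (simp add: cyclic_pair_cocyclic)
  qed
  then show ?thesis unfolding dominating_set_def pv by blast
next
  case False
  then show ?thesis
    by (simp add: dominating_set_def noncyclic_graph_def graph_complement_def cyclicizer_trivial)
qed

lemma \<gamma>_le:
  assumes "D \<subseteq> V" "\<And>v. v \<in> V - D \<Longrightarrow> \<exists>d\<in>D. \<not> cocyclic v d"
  shows "\<gamma> \<le> card D"
  by (rule domination_number_le) (use assms finite_subset_V in \<open>auto simp: dominating_noncyclic_iff\<close>)

lemma \<gamma>'_le:
  assumes "D \<subseteq> V" "\<And>v. v \<in> V - D \<Longrightarrow> \<exists>d\<in>D. cocyclic v d"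
  shows "\<gamma>' \<le> card D"
  by (rule domination_number_le) (use assms finite_subset_V in \<open>auto simp: dominating_complement_iff\<close>)

lemma \<gamma>_attained:
  obtains D where "D \<subseteq> V" "\<And>v. v \<in> V - D \<Longrightarrow> \<exists>d\<in>D. \<not> cocyclic v d" "card D = \<gamma>"
proof -
  have "finite (pverts (noncyclic_graph G))" by (simp add: noncyclic_graph_def)
  then show thesis
    using domination_number_attained that dominating_noncyclic_iff by metis
qed

lemma \<gamma>'_attained:
  obtains D where "D \<subseteq> V" "\<And>v. v \<in> V - D \<Longrightarrow> \<exists>d\<in>D. cocyclic v d" "card D = \<gamma>'"
proof -
  have "finite (pverts (graph_complement (noncyclic_graph G)))"
    by (simp add: noncyclic_graph_def graph_complement_def)
  then show thesis
    using domination_number_attained that dominating_complement_iff by metis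
qed

lemma \<gamma>_pos: "\<gamma> \<ge> 1"
proof -
  obtain D where D: "D \<subseteq> V" "\<And>v. v \<in> V - D \<Longrightarrow> \<exists>d\<in>D. \<not> cocyclic v d" "card D = \<gamma>"
    using \<gamma>_attained by blast
  have "D \<noteq> {}" using D(2) V_nonempty by blast
  moreover have "finite D" using D(1) finite_subset by blast
  ultimately have "card D > 0" by (simp add: card_gt_0_iff)
  then show ?thesis using D(3) by simp
qed

text \<open>
  Isolation is meant in the complement graph: an isolated vertex there is adjacent to all other
  vertices of the non-cyclic graph and so dominates it alone.
\<close>

definition isolated :: "'a \<Rightarrow> bool" where
  "isolated t \<longleftrightarrow> t \<in> V \<and> (\<forall>v\<in>V. cocyclic t v \<longrightarrow> v = t)"

lemma \<gamma>_eq_1_if_isolated: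
  assumes "isolated t"
  shows "\<gamma> = 1"
proof -
  have "\<gamma> \<le> card {t}"
    by (rule \<gamma>_le) (use assms cocyclic_sym in \<open>auto simp: isolated_def\<close>)
  then show ?thesis using \<gamma>_pos by simp
qed

lemma maximal_involution_isolated:
  assumes "maximal_cyclic t" "ord t = 2"
  shows "isolated t"
proof -
  have t: "t \<in> carrier G" using assms(1) by (simp add: maximal_cyclic_def)
  have "t \<noteq> \<one>" using assms(2) by auto
  have "v = t" if "v \<in> V" "cocyclic t v" for v
  proof -
    have "v \<in> cyc t" using maximal_cyclic_cocyclic assms(1) that(2) by blast
    then obtain k :: nat where "k < 2" "v = t [^] k" using cyc_natE[OF _ t] assms(2) by metis
    then show ?thesis using that(1) t by (cases "k = 0") (auto simp: less_2_cases_iff)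
  qed
  then show ?thesis using t \<open>t \<noteq> \<one>\<close> by (auto simp: isolated_def)
qed

text \<open>
  Only vertices in \<open>cyc x\<close> escape being dominated by \<open>x\<close>. Such a vertex \<open>v\<close> has order
  divisible by some prime \<open>p\<close>, hence \<open>cyc v\<close> contains the subgroup of order \<open>p\<close> of \<open>cyc x\<close>. A
  generator of this subgroup is not in the cyclicizer, and any element \<open>h p\<close> that shares no
  cyclic subgroup with it shares none with \<open>v\<close> either. One \<open>h p\<close> for each \<open>p\<close> suffices.
\<close>

lemma \<gamma>_le_maximal:
  assumes x: "maximal_cyclic x" "x \<noteq> \<one>"
  shows "\<gamma> \<le> 1 + card (prime_factors (ord x))"
proof -
  have xG: "x \<in> carrier G" using x(1) by (simp add: maximal_cyclic_def)
  let ?P = "prime_factors (ord x)"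
  let ?e = "\<lambda>p. x [^] (ord x div p)"
  have pow_V: "?e p \<in> V" if "p \<in> ?P" for p
  proof -
    have p: "p dvd ord x" "p > 1" using that prime_gt_1_nat by (auto simp: prime_factors_dvd)
    have "\<not> ord x dvd ord x div p"
      using p xG ord_pos[OF xG] by (simp add: nat_dvd_not_less div_greater_zero_iff dvd_imp_le)
    then show ?thesis using xG by (simp add: pow_eq_id)
  qed
  have "\<exists>g. g \<in> V \<and> \<not> cocyclic (?e p) g" if "p \<in> ?P" for p
    by (rule exists_not_cocyclic[OF pow_V[OF that]]) blast
  then obtain h where h: "\<And>p. p \<in> ?P \<Longrightarrow> h p \<in> V \<and> \<not> cocyclic (?e p) (h p)" by metis
  let ?D = "insert x (h ` ?P)"
  have "\<gamma> \<le> card ?D"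
  proof (rule \<gamma>_le)
    fix v assume v: "v \<in> V - ?D"
    show "\<exists>d\<in>?D. \<not> cocyclic v d"
    proof (cases "cocyclic v x")
      case True
      then have vx: "v \<in> cyc x" using maximal_cyclic_cocyclic[OF x(1)] cocyclic_sym by blast
      have "ord v \<noteq> 1" using v ord_eq_1 by blast
      then obtain p where p: "Factorial_Ring.prime p" "p dvd ord v" using prime_factor_nat by blast
      have "p dvd ord x" using p(2) ord_dvd_of_mem_cyc[OF xG vx] by (rule dvd_trans)
      then have pP: "p \<in> ?P" using p ord_pos[OF xG] by (auto simp: prime_factors_dvd)
      have "?e p \<in> cyc v" using prime_order_power_mem[OF xG vx p] .
      then have "\<not> cocyclic v (h p)" using h[OF pP] cocyclic_cyc by blast
      then show ?thesis using pP by blast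
    qed auto
  qed (use h xG x(2) in auto)
  also have "\<dots> \<le> 1 + card (h ` ?P)" by (simp add: card_insert_if)
  also have "\<dots> \<le> 1 + card ?P" by (simp add: card_image_le)
  finally show ?thesis .
qed

lemma three_maximal_cyclic:
  assumes x: "maximal_cyclic x"
  obtains z w where "maximal_cyclic z" "maximal_cyclic w" "z \<notin> cyc x" "w \<notin> cyc x" "w \<notin> cyc z"
proof -
  have xG: "x \<in> carrier G" using x by (simp add: maximal_cyclic_def)
  obtain a where a: "a \<in> carrier G" "a \<notin> cyc x" using cyc_proper[OF xG] by blast
  obtain z where z: "maximal_cyclic z" "a \<in> cyc z" using maximal_cyclic_above a(1) by blast
  have zG: "z \<in> carrier G" using z by (simp add: maximal_cyclic_def)
  have zx: "z \<notin> cyc x" using cyc_mono[OF xG] z(2) a(2) by blast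
  then have xz: "x \<notin> cyc z" using x zG by (auto simp: maximal_cyclic_def)
  then show thesis using that third_maximal_cyclic[OF xG zG _ zx] z(1) zx by blast
qed

text \<open>
  A dominating set of the complement may leave out the \<open>k\<close> vertices in \<open>R\<close>, because they are
  dominated by the vertices in \<open>D\<close>. The support \<open>T\<close> records which vertices are involved, so
  that savings with disjoint supports do not interfere.
\<close>

definition spares :: "'a set \<Rightarrow> nat \<Rightarrow> bool" where
  "spares T k \<longleftrightarrow> (\<exists>R D. R \<subseteq> V \<and> D \<subseteq> V \<and> R \<union> D \<subseteq> T \<and> R \<inter> D = {} \<and>
     (\<forall>r\<in>R. \<exists>d\<in>D. cocyclic r d) \<and> card R = k)"

lemma spares_bound:
  assumes "spares T k"
  shows "\<gamma>' + k + 1 \<le> order G"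
proof -
  obtain R D where R: "R \<subseteq> V" "D \<subseteq> V" "R \<inter> D = {}" "\<forall>r\<in>R. \<exists>d\<in>D. cocyclic r d" "card R = k"
    using assms unfolding spares_def by blast
  have "\<gamma>' \<le> card (V - R)" by (rule \<gamma>'_le) (use R in blast)+
  also have "\<dots> = card V - k"
    using R(1,5) finite_subset_V by (subst card_Diff_subset) auto
  finally show ?thesis
    using card_V card_mono[OF _ R(1)] R(5) by simp
qed

lemma spares_Un:
  assumes "spares S k" "spares T l" "S \<inter> T = {}"
  shows "spares (S \<union> T) (k + l)"
proof -
  obtain R D where R: "R \<subseteq> V" "D \<subseteq> V" "R \<union> D \<subseteq> S" "R \<inter> D = {}"
      "\<forall>r\<in>R. \<exists>d\<in>D. cocyclic r d" "card R = k"
    using assms(1) unfolding spares_def by blast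
  obtain Q E where Q: "Q \<subseteq> V" "E \<subseteq> V" "Q \<union> E \<subseteq> T" "Q \<inter> E = {}"
      "\<forall>r\<in>Q. \<exists>d\<in>E. cocyclic r d" "card Q = l"
    using assms(2) unfolding spares_def by blast
  have "finite R" "finite Q" using R(1) Q(1) finite_subset by blast+
  moreover have "R \<inter> Q = {}" using R(3) Q(3) assms(3) by blast
  ultimately have "card (R \<union> Q) = k + l" using R(6) Q(6) by (simp add: card_Un_disjoint)
  moreover have "(R \<union> Q) \<inter> (D \<union> E) = {}" using R(3,4) Q(3,4) assms(3) by blast
  moreover have "\<forall>r\<in>R \<union> Q. \<exists>d\<in>D \<union> E. cocyclic r d" using R(5) Q(5) by blast
  moreover have "R \<union> Q \<subseteq> V" "D \<union> E \<subseteq> V" "(R \<union> Q) \<union> (D \<union> E) \<subseteq> S \<union> T"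
    using R(1-3) Q(1-3) by auto
  ultimately show ?thesis unfolding spares_def by blast
qed

lemma spares_mono: "spares S k \<Longrightarrow> S \<subseteq> T \<Longrightarrow> spares T k"
  unfolding spares_def by (elim exE conjE) (intro exI conjI, assumption+, rule order.trans)

text \<open>
  All elements of \<open>cyc x\<close> are adjacent to \<open>x\<close> in the complement, so of the non-identity elements
  only \<open>x\<close> has to be kept.
\<close>

lemma spares_cyc:
  assumes "x \<in> V"
  shows "spares (cyc x - {\<one>}) (ord x - 2)"
  unfolding spares_def
proof (intro exI conjI)
  show "cyc x - {\<one>, x} \<subseteq> V" using assms cyc_carrier by blast
  show "\<forall>r\<in>cyc x - {\<one>, x}. \<exists>d\<in>{x}. cocyclic r d"
    using assms cocyclic_mem cocyclic_sym by blast
  show "card (cyc x - {\<one>, x}) = ord x - 2"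
    using assms by (subst card_Diff_subset) (auto simp: cyc_card)
qed (use assms in auto)

lemma spares_inverse:
  assumes "x \<in> carrier G" "inv x \<noteq> x"
  shows "spares {x, inv x} 1"
  unfolding spares_def
proof (intro exI conjI)
  have "x \<noteq> \<one>" using assms(2) by auto
  then have "x \<in> V" "inv x \<in> V" using assms(1) inv_eq_1_iff by auto
  then show "{inv x} \<subseteq> V" "{x} \<subseteq> V" by auto
  show "\<forall>r\<in>{inv x}. \<exists>d\<in>{x}. cocyclic r d"
    using assms(1) cocyclic_mem cocyclic_sym cyc_inv cyc_self by blast
qed (use assms in auto)

end

section \<open>Subgroups of order three\<close>

context finite_group
begin

abbreviation conj :: "'a \<Rightarrow> 'a \<Rightarrow> 'a" where
  "conj g a \<equiv> g \<otimes> a \<otimes> inv g"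

lemma conj_mult:
  "g \<in> carrier G \<Longrightarrow> h \<in> carrier G \<Longrightarrow> a \<in> carrier G \<Longrightarrow> conj g (conj h a) = conj (g \<otimes> h) a"
  by (simp add: m_assoc inv_mult_group)

lemma conj_inv:
  "g \<in> carrier G \<Longrightarrow> a \<in> carrier G \<Longrightarrow> conj g (inv a) = inv (conj g a)"
  by (simp add: m_assoc inv_mult_group)

lemma conj_eq_self_iff:
  "g \<in> carrier G \<Longrightarrow> a \<in> carrier G \<Longrightarrow> conj g a = a \<longleftrightarrow> g \<otimes> a = a \<otimes> g"
  by (metis inv_solve_right m_closed)

lemma conj_nat_pow:
  assumes "g \<in> carrier G" "a \<in> carrier G"
  shows "conj g a [^] (k::nat) = conj g (a [^] k)"
proof (induction k)
  case (Suc k)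
  have "conj g (a [^] k) \<otimes> conj g a = g \<otimes> (a [^] k \<otimes> (inv g \<otimes> g) \<otimes> a) \<otimes> inv g"
    using assms by (simp only: m_assoc m_closed inv_closed nat_pow_closed)
  then show ?case using Suc assms by simp
qed (use assms in simp)

lemma conj_cancel:
  "g \<in> carrier G \<Longrightarrow> a \<in> carrier G \<Longrightarrow> b \<in> carrier G \<Longrightarrow> conj g a = conj g b \<longleftrightarrow> a = b"
  by simp

lemma ord_conj:
  assumes "g \<in> carrier G" "a \<in> carrier G"
  shows "ord (conj g a) = ord a"
proof -
  have "conj g (a [^] n) = \<one> \<longleftrightarrow> a [^] n = \<one>" for n :: nat
    using conj_cancel[of g "a [^] n" \<one>] assms by simp
  then have "conj g a [^] n = \<one> \<longleftrightarrow> ord a dvd n" for n :: nat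
    unfolding conj_nat_pow[OF assms] using pow_eq_id[OF assms(2)] by simp
  then show ?thesis using ord_unique assms by simp
qed

lemma conj_mem_cyc_iff:
  assumes "g \<in> carrier G" "a \<in> carrier G" "b \<in> carrier G"
  shows "conj g a \<in> cyc (conj g b) \<longleftrightarrow> a \<in> cyc b"
proof
  assume "a \<in> cyc b"
  then obtain k :: nat where "a = b [^] k" using cyc_natE assms(3) by metis
  then have "conj g a = conj g b [^] k" using assms by (simp only: conj_nat_pow)
  then show "conj g a \<in> cyc (conj g b)" using cyc_nat_pow assms by simp
next
  assume "conj g a \<in> cyc (conj g b)"
  then obtain k :: nat where "conj g a = conj g b [^] k"
    using cyc_natE assms m_closed inv_closed by metis
  then have "conj g a = conj g (b [^] k)" using assms by (simp only: conj_nat_pow)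
  then have "a = b [^] k" using conj_cancel assms by simp
  then show "a \<in> cyc b" using cyc_nat_pow assms by simp
qed

lemma ord_3I:
  assumes "a \<in> carrier G" "a [^] (3::nat) = \<one>" "a \<noteq> \<one>"
  shows "ord a = 3"
proof -
  have "ord a dvd 3" using assms pow_eq_id by metis
  moreover have "Factorial_Ring.prime (3::nat)" by simp
  moreover have "ord a \<noteq> 1" using assms ord_eq_1 by blast
  ultimately show ?thesis by (metis prime_nat_iff)
qed

lemma ord_3_facts:
  assumes "a \<in> carrier G" "ord a = 3"
  shows "a \<noteq> \<one>" "a \<otimes> a = inv a" "inv a \<noteq> a" "cyc a = {\<one>, a, inv a}"
proof -
  show ne: "a \<noteq> \<one>" using assms by auto
  have "a [^] (3::nat) = \<one>" using assms pow_ord_eq_1 by metis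
  then have "a \<otimes> a \<otimes> a = \<one>" using assms by (simp add: numeral_3_eq_3)
  then show sq: "a \<otimes> a = inv a" using assms(1) by (metis inv_equality m_closed inv_inv)
  have "cyc a \<subseteq> {\<one>, a, inv a}"
  proof
    fix b assume "b \<in> cyc a"
    then obtain k :: nat where k: "k < 3" "b = a [^] k" using cyc_natE assms by metis
    then have "k = 0 \<or> k = 1 \<or> k = 2" by auto
    then show "b \<in> {\<one>, a, inv a}"
      using k(2) assms(1) sq by (auto simp: numeral_2_eq_2)
  qed
  then show eq: "cyc a = {\<one>, a, inv a}" using cyc_inv[OF assms(1) cyc_self] by auto
  have "card (cyc a) = 3" using assms by (simp add: cyc_card)
  then show "inv a \<noteq> a" using ne unfolding eq by auto
qed

lemma ord_3_mem_sym:
  assumes "a \<in> carrier G" "b \<in> carrier G" "ord a = 3" "ord b = 3" "a \<in> cyc b"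
  shows "b \<in> cyc a"
  using cyc_eq_if_ord_le[OF assms(2,5)] assms(3,4) cyc_self[of b] by (metis order.refl)

text \<open>
  The automorphism group of a group of order three has order two.
\<close>

lemma square_centralizes_ord_3:
  assumes "g \<in> carrier G" "a \<in> carrier G" "ord a = 3" "conj g a \<in> cyc a"
  shows "conj g (conj g a) = a"
proof -
  have "conj g a \<in> {\<one>, a, inv a}" using assms ord_3_facts(4) by blast
  moreover have "conj g a \<noteq> \<one>"
    using ord_3_facts(1)[of "conj g a"] ord_conj assms by simp
  ultimately consider "conj g a = a" | "conj g a = inv a" by blast
  then show ?thesis
  proof cases
    case 2
    then have "conj g (conj g a) = conj g (inv a)" by simp
    also have "\<dots> = inv (conj g a)" using assms conj_inv by blast
    finally show ?thesis using 2 assms by simp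
  qed simp
qed

lemma ord_3_normalizes_centralizes:
  assumes x: "x \<in> carrier G" "ord x = 3" and y: "y \<in> carrier G" "ord y = 3"
    and conj: "conj x y \<in> cyc y"
  shows "x \<otimes> y = y \<otimes> x"
proof -
  have "conj x (conj x y) = y" using square_centralizes_ord_3 x y conj by blast
  then have "conj x y = conj x (conj x (conj x y))" by simp
  also have "\<dots> = conj (x \<otimes> (x \<otimes> x)) y"
    using x y by (simp only: conj_mult m_closed)
  also have "x \<otimes> (x \<otimes> x) = \<one>" using ord_3_facts(2)[OF x] x by simp
  finally have "conj x y = y" using y by simp
  then show ?thesis using conj_eq_self_iff x y by simp
qed

text \<open>
  If \<open>x\<close> does not normalise \<open>cyc y\<close>, the conjugates of \<open>cyc y\<close> under \<open>x\<close> are three distinct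
  subgroups besides \<open>cyc x\<close>. If it does, \<open>x\<close> and \<open>y\<close> commute and generate a group of order
  nine, whose four subgroups of order three are those of \<open>x\<close>, \<open>y\<close>, \<open>x \<otimes> y\<close> and
  \<open>x \<otimes> inv y\<close>.
\<close>

lemma four_subgroups_ord_3:
  assumes x: "x \<in> carrier G" "ord x = 3" and y: "y \<in> carrier G" "ord y = 3"
    and xy: "y \<notin> cyc x"
  obtains z w where "z \<in> carrier G" "ord z = 3" "w \<in> carrier G" "ord w = 3"
    "z \<notin> cyc x" "z \<notin> cyc y" "w \<notin> cyc x" "w \<notin> cyc y" "w \<notin> cyc z"
proof (cases "conj x y \<in> cyc y")
  case False
  define z w where "z = conj x y" and "w = conj x z"
  have zG: "z \<in> carrier G" and wG: "w \<in> carrier G" using x y by (auto simp: z_def w_def)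
  have "ord z = 3" "ord w = 3" using ord_conj x y zG by (simp_all add: z_def w_def)
  moreover have outside: "conj x a \<notin> cyc x" if "a \<in> carrier G" "a \<notin> cyc x" for a
  proof -
    have "conj x x = x" using x conj_eq_self_iff by simp
    then show ?thesis using conj_mem_cyc_iff[OF x(1) that(1) x(1)] that(2) by metis
  qed
  moreover have "z \<notin> cyc x" using outside y xy by (simp add: z_def)
  moreover have "w \<notin> cyc x" using outside \<open>z \<notin> cyc x\<close> zG by (simp add: w_def)
  moreover have "z \<notin> cyc y" using False by (simp add: z_def)
  moreover have "w \<notin> cyc z"
    using conj_mem_cyc_iff[OF x(1) zG y(1)] \<open>z \<notin> cyc y\<close> by (simp add: w_def z_def)
  \<comment> \<open>Conjugating thrice by \<open>x\<close> is trivial, so \<open>w \<in> cyc y\<close> would give \<open>y \<in> cyc z\<close>.\<close>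
  moreover have "w \<notin> cyc y"
  proof
    assume "w \<in> cyc y"
    then have "conj x w \<in> cyc z" using conj_mem_cyc_iff x y wG by (simp add: z_def)
    moreover have "conj x w = conj (x \<otimes> (x \<otimes> x)) y"
      unfolding w_def z_def using x y by (simp only: conj_mult m_closed)
    moreover have "x \<otimes> (x \<otimes> x) = \<one>" using ord_3_facts(2)[OF x] x by simp
    ultimately have "y \<in> cyc z" using y by simp
    then show False using ord_3_mem_sym y zG \<open>ord z = 3\<close> \<open>z \<notin> cyc y\<close> by blast
  qed
  ultimately show thesis using that zG wG by blast
next
  case True
  then have comm: "x \<otimes> y = y \<otimes> x" using ord_3_normalizes_centralizes x y by blast
  have yx: "x \<notin> cyc y" using ord_3_mem_sym x y xy by blast
  define z w where "z = x \<otimes> y" and "w = x \<otimes> inv y"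
  have zG: "z \<in> carrier G" and wG: "w \<in> carrier G" using x y by (auto simp: z_def w_def)
  have x_z: "x = z \<otimes> inv y" and y_z: "y = inv x \<otimes> z"
    using x y unfolding z_def by (simp_all add: inv_solve_right inv_solve_left m_assoc)
  have x_w: "x = w \<otimes> y" and y_w: "y = inv w \<otimes> x"
    using x y unfolding w_def by (simp_all add: m_assoc inv_mult_group)
  have z: "z \<notin> cyc x" "z \<notin> cyc y"
    using xy yx x_z y_z cyc_mult cyc_inv cyc_self x y by metis+
  have w: "w \<notin> cyc x" "w \<notin> cyc y"
    using xy yx x_w y_w cyc_mult cyc_inv cyc_self x y by metis+
  have "inv y \<otimes> x = x \<otimes> inv y"
    using comm x y by (metis inv_solve_left inv_solve_right m_assoc m_closed inv_closed)
  have p3: "a [^] (3::nat) = \<one>" if "a \<in> carrier G" "ord a = 3" for a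
    using pow_ord_eq_1[OF that(1)] that(2) by simp
  have "z [^] (3::nat) = \<one>" unfolding z_def using pow_mult_distrib[OF comm] x y p3 by simp
  then have oz: "ord z = 3" using ord_3I zG z(1) cyc_one by metis
  have "w [^] (3::nat) = \<one>" unfolding w_def
    using pow_mult_distrib[of x "inv y"] \<open>inv y \<otimes> x = x \<otimes> inv y\<close> x y p3 by simp
  then have ow: "ord w = 3" using ord_3I wG w(1) cyc_one by metis
  have "w \<notin> cyc z"
  proof
    assume "w \<in> cyc z"
    then consider "w = \<one>" | "w = z" | "w = inv z" using ord_3_facts(4)[OF zG oz] by blast
    then show False
    proof cases
      case 1 then show ?thesis using w(1) by simp
    next
      case 2
      then have "inv y = y" using x y by (simp add: z_def w_def)
      then show ?thesis using ord_3_facts(3)[OF y] by simp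
    next
      case 3
      then have "x \<otimes> inv y = inv x \<otimes> inv y"
        using comm x y by (simp add: z_def w_def inv_mult_group)
      then show ?thesis using ord_3_facts(3)[OF x] x y by simp
    qed
  qed
  then show thesis using that zG oz wG ow z w by blast
qed

end

context trivial_cyclicizer_group
begin

lemma spares_four_subgroups:
  assumes "x \<in> carrier G" "ord x = 3" "y \<in> carrier G" "ord y = 3"
    "z \<in> carrier G" "ord z = 3" "w \<in> carrier G" "ord w = 3"
    "y \<notin> cyc x" "z \<notin> cyc x" "z \<notin> cyc y" "w \<notin> cyc x" "w \<notin> cyc y" "w \<notin> cyc z"
  shows "spares (cyc x \<union> cyc y \<union> cyc z \<union> cyc w - {\<one>}) 4"
proof -
  have one: "spares (cyc a - {\<one>}) 1" if "a \<in> carrier G" "ord a = 3" for a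
    using spares_cyc[of a] that ord_3_facts(1) by fastforce
  have disj: "(cyc a - {\<one>}) \<inter> (cyc b - {\<one>}) = {}"
    if "a \<in> carrier G" "b \<in> carrier G" "ord b = 3" "b \<notin> cyc a" for a b
    using cyc_prime_inter[OF that(2,1)] that(3,4) by auto
  have "spares ((cyc x - {\<one>}) \<union> (cyc y - {\<one>})) (1 + 1)"
    by (intro spares_Un one disj) fact+
  moreover have "spares ((cyc z - {\<one>}) \<union> (cyc w - {\<one>})) (1 + 1)"
    by (intro spares_Un one disj) fact+
  moreover have "((cyc x - {\<one>}) \<union> (cyc y - {\<one>})) \<inter> ((cyc z - {\<one>}) \<union> (cyc w - {\<one>})) = {}"
    using disj[OF assms(1,5,6,10)] disj[OF assms(1,7,8,12)] disj[OF assms(3,5,6,11)]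
      disj[OF assms(3,7,8,13)]
    by (simp only: Int_Un_distrib Int_Un_distrib2 Un_empty_left)
  ultimately have "spares (((cyc x - {\<one>}) \<union> (cyc y - {\<one>})) \<union>
      ((cyc z - {\<one>}) \<union> (cyc w - {\<one>}))) ((1 + 1) + (1 + 1))"
    by (rule spares_Un)
  then show ?thesis by (simp add: Un_Diff Un_assoc eval_nat_numeral)
qed

lemma spares_ord_3:
  assumes "x \<in> carrier G" "ord x = 3" "y \<in> carrier G" "ord y = 3" "y \<notin> cyc x"
  shows "spares {a \<in> carrier G. ord a = 3} 4"
proof -
  obtain z w where zw: "z \<in> carrier G" "ord z = 3" "w \<in> carrier G" "ord w = 3"
    "z \<notin> cyc x" "z \<notin> cyc y" "w \<notin> cyc x" "w \<notin> cyc y" "w \<notin> cyc z"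
    using four_subgroups_ord_3[OF assms] by blast
  have "cyc a - {\<one>} \<subseteq> {a \<in> carrier G. ord a = 3}" if "a \<in> carrier G" "ord a = 3" for a
    using ord_3_facts(4)[OF that] that by auto
  then have "cyc x \<union> cyc y \<union> cyc z \<union> cyc w - {\<one>} \<subseteq> {a \<in> carrier G. ord a = 3}"
    using assms zw by (simp add: Un_Diff)
  then show ?thesis using spares_four_subgroups assms zw spares_mono by blast
qed

end

section \<open>Recognising the groups\<close>

context finite_group
begin

lemma elementary_abelian_2_iff:
  "elementary_abelian_group 2 G \<longleftrightarrow> (\<forall>x\<in>carrier G. x \<otimes> x = \<one>)"
proof
  assume el: "elementary_abelian_group 2 G"
  show "\<forall>x\<in>carrier G. x \<otimes> x = \<one>"
  proof
    fix x assume x: "x \<in> carrier G"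
    show "x \<otimes> x = \<one>"
    proof (cases "x = \<one>")
      case False
      then have "ord x = 2" using el x by (simp add: elementary_abelian_group_def)
      then have "x [^] (2::nat) = \<one>" using x pow_ord_eq_1 by metis
      then show ?thesis using x by (simp add: numeral_2_eq_2)
    qed simp
  qed
next
  assume sq: "\<forall>x\<in>carrier G. x \<otimes> x = \<one>"
  have "x \<otimes> y = y \<otimes> x" if xy: "x \<in> carrier G" "y \<in> carrier G" for x y
  proof -
    have self_inv: "inv a = a" if "a \<in> carrier G" for a
      using sq that inv_equality by blast
    have "x \<otimes> y = inv (x \<otimes> y)" using self_inv[of "x \<otimes> y"] xy by simp
    also have "\<dots> = inv y \<otimes> inv x" using xy by (rule inv_mult_group)
    also have "\<dots> = y \<otimes> x" using self_inv xy by simp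
    finally show ?thesis .
  qed
  then have "comm_group G" by (rule group_comm_groupI)
  moreover have "ord x = 2" if "x \<in> carrier G" "x \<noteq> \<one>" for x
  proof -
    have "x [^] (2::nat) = \<one>" using sq that by (simp add: numeral_2_eq_2)
    then have "ord x dvd 2" using that pow_eq_id by metis
    moreover have "ord x \<noteq> 1" using that ord_eq_1 by blast
    ultimately show ?thesis using two_is_prime_nat by (metis prime_nat_iff)
  qed
  ultimately show "elementary_abelian_group 2 G"
    by (simp add: elementary_abelian_group_def)
qed

text \<open>
  In a dihedral group of order at least six this describes the generators of the rotation
  subgroup. The trivial case \<open>c = \<one>\<close> describes the groups of exponent dividing two, so that
  both families can be treated alike.
\<close>

definition rotation :: "'a \<Rightarrow> bool" where
  "rotation c \<longleftrightarrow> c \<in> carrier G \<and> (\<forall>t\<in>carrier G - cyc c. t \<otimes> t = \<one>)"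

lemma cyc_outside_mult:
  assumes "c \<in> carrier G" "a \<in> cyc c" "t \<in> carrier G" "t \<notin> cyc c"
  shows "a \<otimes> t \<notin> cyc c" "t \<otimes> a \<notin> cyc c"
proof -
  have aG: "a \<in> carrier G" using assms cyc_carrier by blast
  have "t = inv a \<otimes> (a \<otimes> t)" "t = (t \<otimes> a) \<otimes> inv a"
    using aG assms by (simp_all add: m_assoc inv_solve_left)
  then show "a \<otimes> t \<notin> cyc c" "t \<otimes> a \<notin> cyc c"
    using cyc_mult cyc_inv assms by metis+
qed

text \<open>
  If \<open>t\<close> lies outside \<open>cyc c\<close>, so does \<open>t \<otimes> a\<close>, and both square to \<open>\<one>\<close>; this is the relation
  between a reflection and a rotation.
\<close>

lemma rotation_inverted:
  assumes c: "rotation c" and a: "a \<in> cyc c" and t: "t \<in> carrier G" "t \<notin> cyc c"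
  shows "t \<otimes> a = inv a \<otimes> t"
proof -
  have cG: "c \<in> carrier G" using c by (simp add: rotation_def)
  have aG: "a \<in> carrier G" using cG a cyc_carrier by blast
  have "(t \<otimes> a) \<otimes> (t \<otimes> a) = \<one>" "t \<otimes> t = \<one>"
    using c t aG cyc_outside_mult[OF cG a t] by (auto simp: rotation_def)
  then have "inv (t \<otimes> a) = t \<otimes> a" "inv t = t" using aG t inv_equality by auto
  then show ?thesis using aG t by (simp add: inv_mult_group)
qed

text \<open>
  A product of two elements that invert \<open>c\<close> centralises \<open>c\<close>. If it were outside \<open>cyc c\<close>, it
  would also invert \<open>c\<close>, and the order of \<open>c\<close> would be at most two.
\<close>

lemma rotation_index_two:
  assumes c: "rotation c" and ord: "ord c \<ge> 3"
    and s: "s \<in> carrier G" "s \<notin> cyc c" and t: "t \<in> carrier G" "t \<notin> cyc c"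
  shows "s \<otimes> t \<in> cyc c"
proof (rule ccontr)
  assume out: "s \<otimes> t \<notin> cyc c"
  have cG: "c \<in> carrier G" using c by (simp add: rotation_def)
  have icG: "inv c \<in> cyc c" using cG cyc_inv by simp
  have "inv c \<otimes> (s \<otimes> t) = s \<otimes> t \<otimes> c"
    using rotation_inverted[OF c cyc_self _ out] s t by simp
  also have "\<dots> = s \<otimes> (inv c \<otimes> t)"
    using rotation_inverted[OF c cyc_self t] s t cG by (simp add: m_assoc)
  also have "\<dots> = (s \<otimes> inv c) \<otimes> t" using s t cG by (simp add: m_assoc)
  also have "\<dots> = c \<otimes> (s \<otimes> t)"
    using rotation_inverted[OF c icG s] s t cG by (simp add: m_assoc)
  finally have "inv c = c" using s t cG by simp
  then have "c [^] (2::nat) = \<one>" using r_inv[OF cG] cG by (simp add: numeral_2_eq_2)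
  then have "ord c dvd 2" using cG pow_eq_id by metis
  then have "ord c \<le> 2" by (rule dvd_imp_le) simp
  then show False using ord by simp
qed

lemma int_pow_mod_ord:
  assumes "c \<in> carrier G"
  shows "c [^] (k mod int (ord c)) = c [^] (k::int)"
  using int_pow_eq[OF assms] by (simp add: minus_mod_eq_mult_div)

lemma cyc_int_powE:
  assumes "a \<in> cyc c" "c \<in> carrier G"
  obtains k :: int where "0 \<le> k" "k < int (ord c)" "a = c [^] k"
proof -
  obtain k :: nat where "k < ord c" "a = c [^] k" using cyc_natE assms by metis
  then show thesis using that[of "int k"] by (simp add: int_pow_int)
qed

lemma int_pow_inj:
  assumes "c \<in> carrier G" "c [^] (a::int) = c [^] b"
    "0 \<le> a" "a < int (ord c)" "0 \<le> b" "b < int (ord c)"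
  shows "a = b"
proof -
  have "int (ord c) dvd b - a" using int_pow_eq assms by blast
  then have "b mod int (ord c) = a mod int (ord c)" by (simp add: mod_eq_dvd_iff)
  then show ?thesis using assms by simp
qed

lemma iso_dihedral_group:
  assumes c: "rotation c" and ord: "ord c \<ge> 3" and proper: "cyc c \<noteq> carrier G"
  shows "G \<cong> dihedral_group (ord c)"
proof -
  have cG: "c \<in> carrier G" using c by (simp add: rotation_def)
  then obtain t where t: "t \<in> carrier G" "t \<notin> cyc c"
    using proper cyc_subset_carrier by blast
  let ?D = "dihedral_group (ord c)"
  define \<phi> where "\<phi> = (\<lambda>(a::int, s). c [^] a \<otimes> (if s then t else \<one>))"
  have tt: "t \<otimes> t = \<one>" using c t by (simp add: rotation_def)
  have flip: "t \<otimes> c [^] b = c [^] (- b) \<otimes> t" for b :: int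
    using rotation_inverted[OF c cyc_int_pow[OF cG] t] cG by (simp add: int_pow_neg)
  have diff: "c [^] (a - b) = c [^] a \<otimes> c [^] (- b)" for a b :: int
    using int_pow_mult[OF cG, of a "- b"] by simp
  have hom: "\<phi> ((a, s) \<otimes>\<^bsub>?D\<^esub> (b, u)) = \<phi> (a, s) \<otimes> \<phi> (b, u)" for a b s u
  proof (cases s)
    case False
    then show ?thesis using cG t
      by (simp add: \<phi>_def dihedral_group_def int_pow_mod_ord int_pow_mult m_assoc)
  next
    case True
    have "\<phi> (a, s) \<otimes> \<phi> (b, u) = c [^] a \<otimes> (t \<otimes> c [^] b) \<otimes> (if u then t else \<one>)"
      using True cG t by (simp add: \<phi>_def m_assoc)
    also have "\<dots> = c [^] (a - b) \<otimes> (t \<otimes> (if u then t else \<one>))"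
      unfolding flip diff using cG t by (simp add: m_assoc)
    also have "t \<otimes> (if u then t else \<one>) = (if \<not> u then t else \<one>)"
      using tt t by simp
    finally show ?thesis using True cG
      by (simp add: \<phi>_def dihedral_group_def int_pow_mod_ord)
  qed
  have carrier_D: "carrier ?D = {0..<int (ord c)} \<times> UNIV" by (simp add: dihedral_group_def)
  have bij: "bij_betw \<phi> (carrier ?D) (carrier G)"
  proof (rule bij_betw_imageI)
    show "inj_on \<phi> (carrier ?D)"
    proof (rule inj_onI)
      fix p q assume pq: "p \<in> carrier ?D" "q \<in> carrier ?D" "\<phi> p = \<phi> q"
      obtain a s where p: "p = (a, s)" by (cases p)
      obtain b u where q: "q = (b, u)" by (cases q)
      have "\<phi> r \<in> cyc c \<longleftrightarrow> \<not> snd r" for r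
        using cyc_outside_mult(1)[OF cG cyc_int_pow[OF cG, of "fst r"] t] cG cyc_int_pow[OF cG]
        by (cases r) (simp add: \<phi>_def)
      then have su: "s = u" using pq(3) p q by (metis snd_conv)
      have "c [^] a \<otimes> (if u then t else \<one>) = c [^] b \<otimes> (if u then t else \<one>)"
        using pq(3) p q su by (simp add: \<phi>_def)
      then have "c [^] a = c [^] b" using cG t by (simp split: if_splits)
      then have "a = b" using pq p q int_pow_inj[OF cG] by (simp add: carrier_D)
      then show "p = q" using p q su by simp
    qed
    show "\<phi> ` carrier ?D = carrier G"
    proof (intro equalityI subsetI)
      fix g assume "g \<in> \<phi> ` carrier ?D"
      then show "g \<in> carrier G" using cG t by (auto simp: \<phi>_def)
    next
      fix g assume g: "g \<in> carrier G"
      show "g \<in> \<phi> ` carrier ?D"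
      proof (cases "g \<in> cyc c")
        case True
        then obtain k :: int where k: "0 \<le> k" "k < int (ord c)" "g = c [^] k"
          using cyc_int_powE cG by metis
        then have "g = \<phi> (k, False)" using cG by (simp add: \<phi>_def)
        moreover have "(k, False) \<in> carrier ?D" using k(1,2) by (simp add: carrier_D)
        ultimately show ?thesis by (rule image_eqI)
      next
        case False
        then obtain k :: int where k: "0 \<le> k" "k < int (ord c)" "g \<otimes> t = c [^] k"
          using cyc_int_powE cG rotation_index_two[OF c ord g _ t] by metis
        have "g = g \<otimes> t \<otimes> t" using g t tt by (simp add: m_assoc)
        then have "g = \<phi> (k, True)" using k(3) by (simp add: \<phi>_def)
        moreover have "(k, True) \<in> carrier ?D" using k(1,2) by (simp add: carrier_D)
        ultimately show ?thesis by (rule image_eqI)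
      qed
    qed
  qed
  have "\<phi> \<in> iso ?D G"
    unfolding iso_def hom_def using hom bij cG t by (auto simp: bij_betw_def)
  moreover have "group ?D" using group_dihedral_group ord by simp
  ultimately show ?thesis using group.iso_sym is_isoI by blast
qed

lemma dihedral_group_rotation:
  assumes iso: "G \<cong> dihedral_group m" and m: "m > 1"
  obtains c where "rotation c" "ord c = m" "order G = 2 * m"
proof -
  let ?D = "dihedral_group m"
  interpret D: group ?D using group_dihedral_group m by simp
  obtain f where f: "f \<in> iso ?D G" using iso_sym[OF iso] unfolding is_iso_def by blast
  interpret f: group_hom ?D G f
    using f by (unfold_locales) (auto simp: iso_def)
  define r :: "int \<times> bool" where "r = (1, False)"
  have rD: "r \<in> carrier ?D" using m by (simp add: r_def dihedral_group_def)
  have img: "f ` carrier ?D = carrier G" and inj: "inj_on f (carrier ?D)"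
    using f by (auto simp: iso_def bij_betw_def)
  have rpow: "r [^]\<^bsub>?D\<^esub> k = (int k mod int m, False)" for k :: nat
  proof (induction k)
    case 0 show ?case by (simp add: dihedral_group_def)
  next
    case (Suc k)
    then show ?case by (simp add: r_def) (simp add: dihedral_group_def mod_simps add.commute)
  qed
  define c where "c = f r"
  have cG: "c \<in> carrier G" using rD by (simp add: c_def)
  have cpow: "c [^] k = f (int k mod int m, False)" for k :: nat
    using f.hom_nat_pow[OF rD, of k] by (simp add: c_def rpow)
  have one: "\<one> = f (0, False)" using f.hom_one by (simp add: dihedral_group_def)
  have mem: "(a, s) \<in> carrier ?D \<longleftrightarrow> 0 \<le> a \<and> a < int m" for a s
    by (auto simp: dihedral_group_def)
  have "c [^] k = \<one> \<longleftrightarrow> m dvd k" for k :: nat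
  proof -
    have "c [^] k = \<one> \<longleftrightarrow> (int k mod int m, False) = (0, False)"
      unfolding cpow one by (rule inj_on_eq_iff[OF inj]) (use m in \<open>simp_all add: mem\<close>)
    also have "\<dots> \<longleftrightarrow> m dvd k" by (simp add: mod_eq_0_iff_dvd)
    finally show ?thesis .
  qed
  then have ordc: "ord c = m" using ord_unique[OF cG] by simp
  have "t \<otimes> t = \<one>" if t: "t \<in> carrier G" "t \<notin> cyc c" for t
  proof -
    obtain a s where as: "(a, s) \<in> carrier ?D" "t = f (a, s)" using t(1) img by force
    have s: s
    proof (rule ccontr)
      assume "\<not> s"
      then have "t = c [^] nat a" using as by (simp add: cpow mem)
      then show False using t(2) cyc_nat_pow[OF cG] by simp
    qed
    have "t \<otimes> t = f ((a, s) \<otimes>\<^bsub>?D\<^esub> (a, s))" using as by simp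
    also have "(a, s) \<otimes>\<^bsub>?D\<^esub> (a, s) = (0, False)" using s by (simp add: dihedral_group_def)
    finally show ?thesis using one by simp
  qed
  then have "rotation c" using cG by (simp add: rotation_def)
  moreover have "order G = 2 * m"
    using iso_same_card[OF iso] order_dihedral_group[of m] by (simp add: order_def)
  ultimately show thesis using that ordc by blast
qed

text \<open>
  The nine products \<open>x [^] i \<otimes> y [^] j\<close> are distinct and hence exhaust the group. Writing \<open>y \<otimes> x\<close>
  in this form leaves four possibilities; all but \<open>y \<otimes> x = x \<otimes> y\<close> make \<open>x\<close> or \<open>y\<close> normalise, hence
  centralise, a subgroup of order three, or make \<open>y \<otimes> x\<close> its own inverse.
\<close>

lemma iso_Z3_Z3:
  assumes exp3: "\<And>a. a \<in> carrier G \<Longrightarrow> a \<noteq> \<one> \<Longrightarrow> ord a = 3"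
    and order: "order G \<le> 9"
    and x: "x \<in> carrier G" "ord x = 3" and y: "y \<in> carrier G" "ord y = 3"
    and yx: "y \<notin> cyc x"
  shows "G \<cong> integer_mod_group 3 \<times>\<times> integer_mod_group 3"
proof -
  let ?Z = "integer_mod_group 3 \<times>\<times> integer_mod_group 3"
  let ?I = "{0..<3::int} \<times> {0..<3::int}"
  have xy: "x \<notin> cyc y" using ord_3_mem_sym x y yx by blast
  have carrier_Z: "carrier ?Z = ?I"
    by (simp add: DirProd_def carrier_integer_mod_group)
  define \<phi> where "\<phi> = (\<lambda>(i::int, j::int). x [^] i \<otimes> y [^] j)"
  have inj: "inj_on \<phi> ?I"
  proof (rule inj_onI)
    fix p q assume pq: "p \<in> ?I" "q \<in> ?I" "\<phi> p = \<phi> q"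
    obtain i j where p: "p = (i, j)" by (cases p)
    obtain k l where q: "q = (k, l)" by (cases q)
    have eq: "x [^] i \<otimes> y [^] j = x [^] k \<otimes> y [^] l" using pq(3) p q by (simp add: \<phi>_def)
    have "x [^] i = x [^] k \<otimes> y [^] l \<otimes> inv (y [^] j)"
      using inv_solve_right[of "x [^] i" "x [^] k \<otimes> y [^] l" "y [^] j"] eq x y by simp
    then have "inv (x [^] k) \<otimes> x [^] i = y [^] l \<otimes> inv (y [^] j)"
      using inv_solve_left[of "y [^] l \<otimes> inv (y [^] j)" "x [^] k" "x [^] i"] x y
      by (simp add: m_assoc)
    moreover have "inv (x [^] k) \<otimes> x [^] i \<in> cyc x" "y [^] l \<otimes> inv (y [^] j) \<in> cyc y"
      using x y cyc_mult cyc_inv cyc_int_pow by simp_all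
    ultimately have "inv (x [^] k) \<otimes> x [^] i = \<one>" "y [^] l \<otimes> inv (y [^] j) = \<one>"
      using cyc_prime_inter[OF x(1) y(1) _ xy] x(2) by simp_all
    then have "x [^] i = x [^] k" "y [^] l = y [^] j"
      using x y by (metis inv_equality inv_inv int_pow_closed inv_closed)+
    then show "p = q" using int_pow_inj[OF x(1)] int_pow_inj[OF y(1)] x(2) y(2) pq p q by simp
  qed
  have sub: "\<phi> ` ?I \<subseteq> carrier G" using x y by (auto simp: \<phi>_def)
  have "card (\<phi> ` ?I) = 9" using card_image[OF inj] by simp
  then have img: "\<phi> ` ?I = carrier G"
    using card_seteq[OF finite_carrier sub] order by (simp add: order_def)
  have comm: "x \<otimes> y = y \<otimes> x"
  proof -
    have "y \<otimes> x \<in> \<phi> ` ?I" using img x y by simp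
    then obtain i j :: int where ij: "i \<in> {0..<3}" "j \<in> {0..<3}" "y \<otimes> x = x [^] i \<otimes> y [^] j"
      by (auto simp: \<phi>_def)
    have pow2: "a [^] (2::int) = inv a" if "a \<in> carrier G" "ord a = 3" for a
    proof -
      have "a [^] (2::int) = a \<otimes> a"
        using that int_pow_int[of G a 2] by (simp add: numeral_2_eq_2)
      then show ?thesis using ord_3_facts(2)[OF that] by simp
    qed
    have yx_out: "y \<otimes> x \<notin> cyc x" "y \<otimes> x \<notin> cyc y"
      using cyc_outside_mult x y xy yx cyc_self by metis+
    have "i \<noteq> 0"
    proof
      assume "i = 0"
      then have "y \<otimes> x = y [^] j" using ij(3) y by simp
      then show False using yx_out(2) cyc_int_pow[OF y(1)] by simp
    qed
    moreover have "j \<noteq> 0"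
    proof
      assume "j = 0"
      then have "y \<otimes> x = x [^] i" using ij(3) x by simp
      then show False using yx_out(1) cyc_int_pow[OF x(1)] by simp
    qed
    ultimately consider "i = 1" "j = 1" | "i = 1" "j = 2" | "i = 2" "j = 1" | "i = 2" "j = 2"
      using ij(1,2) by force
    then show ?thesis
    proof cases
      case 1
      then show ?thesis using ij(3) x y by simp
    next
      case 2
      then have "y \<otimes> x = x \<otimes> inv y" using ij(3) x y pow2 by simp
      then have "conj (inv x) y = inv x \<otimes> (x \<otimes> inv y)" using x y by (simp add: m_assoc)
      also have "\<dots> = inv y" using x y by (simp flip: m_assoc)
      finally have "conj (inv x) y = inv y" .
      then have "conj (inv x) y \<in> cyc y" using cyc_inv y by simp
      then have "inv x \<otimes> y = y \<otimes> inv x"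
        using ord_3_normalizes_centralizes[of "inv x" y] x y by simp
      then show ?thesis using x y by (metis inv_closed inv_solve_left inv_solve_right m_assoc m_closed)
    next
      case 3
      then have "y \<otimes> x = inv x \<otimes> y" using ij(3) x y pow2 by simp
      then have "conj y x = inv x" using x y by (simp add: m_assoc)
      then have "conj y x \<in> cyc x" using cyc_inv x by simp
      then show ?thesis using ord_3_normalizes_centralizes[of y x] x y by simp
    next
      case 4
      then have "y \<otimes> x = inv (y \<otimes> x)" using ij(3) x y pow2 by (simp add: inv_mult_group)
      moreover have "y \<otimes> x \<noteq> \<one>" using yx_out(1) by auto
      ultimately show ?thesis using ord_3_facts(3)[of "y \<otimes> x"] exp3 x y by simp
    qed
  qed
  have comm_pow: "y [^] j \<otimes> x [^] k = x [^] k \<otimes> y [^] j" for j k :: int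
  proof -
    have "conj y x = x" using comm x y by (simp add: conj_eq_self_iff)
    then have *: "conj y (x [^] n) = x [^] n" for n :: nat
      using conj_nat_pow[OF y(1) x(1), of n] by simp
    obtain n :: nat where n: "x [^] k = x [^] n" using cyc_natE[OF cyc_int_pow[OF x(1)] x(1)] by metis
    have "conj (x [^] n) y = y" using *[of n] x y by (simp add: conj_eq_self_iff)
    then have **: "conj (x [^] n) (y [^] m) = y [^] m" for m :: nat
      using conj_nat_pow[of "x [^] n" y m] x y by simp
    obtain m :: nat where m: "y [^] j = y [^] m" using cyc_natE[OF cyc_int_pow[OF y(1)] y(1)] by metis
    show ?thesis using **[of m] x y unfolding n m by (simp add: conj_eq_self_iff)
  qed
  have mod3: "a [^] (k mod 3) = a [^] (k::int)" if "a \<in> carrier G" "ord a = 3" for a k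
    using int_pow_mod_ord[OF that(1), of k] that(2) by simp
  have hom: "\<phi> (p \<otimes>\<^bsub>?Z\<^esub> q) = \<phi> p \<otimes> \<phi> q" for p q
  proof -
    obtain i j where p: "p = (i, j)" by (cases p)
    obtain k l where q: "q = (k, l)" by (cases q)
    have "\<phi> (p \<otimes>\<^bsub>?Z\<^esub> q) = x [^] i \<otimes> (x [^] k \<otimes> y [^] j) \<otimes> y [^] l"
      using x y by (simp add: \<phi>_def p q mod3 int_pow_mult m_assoc)
    also have "\<dots> = \<phi> p \<otimes> \<phi> q"
      unfolding comm_pow[symmetric] using x y by (simp add: \<phi>_def p q m_assoc)
    finally show ?thesis .
  qed
  have "\<phi> \<in> iso ?Z G"
    unfolding iso_def hom_def carrier_Z using hom inj img sub by (auto simp: bij_betw_def)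
  moreover have "group ?Z" by (simp add: DirProd_group)
  ultimately show ?thesis using group.iso_sym is_isoI by blast
qed

lemma Z3_Z3_exponent:
  assumes iso: "G \<cong> integer_mod_group 3 \<times>\<times> integer_mod_group 3"
  shows "order G = 9" "\<And>a. a \<in> carrier G \<Longrightarrow> a \<noteq> \<one> \<Longrightarrow> ord a = 3"
proof -
  let ?Z = "integer_mod_group 3 \<times>\<times> integer_mod_group 3"
  interpret Z: group ?Z by (simp add: DirProd_group)
  show "order G = 9"
    using iso_same_card[OF iso] by (simp add: order_def DirProd_def carrier_integer_mod_group)
  fix a assume a: "a \<in> carrier G" "a \<noteq> \<one>"
  obtain f where f: "f \<in> iso ?Z G" using iso_sym[OF iso] unfolding is_iso_def by blast
  interpret f: group_hom ?Z G f
    using f by (unfold_locales) (auto simp: iso_def)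
  have "f ` carrier ?Z = carrier G" using f by (simp add: iso_def bij_betw_def)
  then obtain p where p: "p \<in> carrier ?Z" "a = f p" using a(1) by blast
  obtain i j where ij: "p = (i, j)" by (cases p)
  have "p [^]\<^bsub>?Z\<^esub> (3::nat) = \<one>\<^bsub>?Z\<^esub>"
    by (simp add: ij numeral_3_eq_3 mod_simps)
  then have "f p [^] (3::nat) = \<one>" using f.hom_nat_pow[OF p(1), of 3] f.hom_one by (simp only:)
  then have "a [^] (3::nat) = \<one>" using p(2) by simp
  then show "ord a = 3" using ord_3I a by blast
qed

end

text \<open>
  The three-cycle \<open>c\<close> is a rotation: a permutation of three points other than \<open>id\<close>, \<open>c\<close> and
  \<open>c \<circ> c\<close> is a transposition.
\<close>

lemma sym_group_3_iso_dihedral_group: "sym_group 3 \<cong> dihedral_group 3"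
proof -
  interpret S: finite_group "sym_group 3"
    by (intro finite_group.intro finite_group_axioms.intro sym_group_is_group)
      (simp add: sym_group_def finite_permutations)
  define c :: "nat \<Rightarrow> nat" where "c = (\<lambda>x. if x = 1 then 2 else if x = 2 then 3 else if x = 3 then 1 else x)"
  have atLeast: "{1..3::nat} = {1, 2, 3}" by auto
  have c: "c \<in> carrier (sym_group 3)"
    unfolding sym_group_carrier atLeast
    by (rule bij_imp_permutes) (auto simp: c_def bij_betw_def inj_on_def)
  have c3: "c \<circ> (c \<circ> c) = id" by (auto simp: c_def fun_eq_iff)
  have ord: "S.ord c = 3"
  proof (rule S.ord_3I[OF c])
    show "c [^]\<^bsub>sym_group 3\<^esub> (3::nat) = \<one>\<^bsub>sym_group 3\<^esub>"
      using c3 by (simp add: sym_group_def numeral_3_eq_3 nat_pow_def comp_assoc)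
    have "c 1 \<noteq> id 1" by (simp add: c_def)
    then show "c \<noteq> \<one>\<^bsub>sym_group 3\<^esub>" by (auto simp: sym_group_def)
  qed
  have cyc: "S.cyc c = {id, c, c \<circ> c}"
    using S.ord_3_facts(2,4)[OF c ord] by (simp add: sym_group_def)
  have "S.rotation c"
    unfolding S.rotation_def cyc
  proof (intro conjI ballI c)
    fix p assume p: "p \<in> carrier (sym_group 3) - {id, c, c \<circ> c}"
    then have perm: "p permutes {1, 2, 3}" using atLeast sym_group_carrier[of p 3] by (metis DiffD1)
    have out: "p x = x" if "x \<noteq> 1" "x \<noteq> 2" "x \<noteq> 3" for x
      using perm that by (simp add: permutes_def)
    have "p 1 \<in> {1, 2, 3}" "p 2 \<in> {1, 2, 3}" "p 3 \<in> {1, 2, 3}"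
      by (simp_all only: permutes_in_image[OF perm]) simp_all
    moreover have "p 1 \<noteq> p 2" "p 1 \<noteq> p 3" "p 2 \<noteq> p 3"
      using inj_eq[OF permutes_inj[OF perm]] by simp_all
    moreover have "\<not> (p 1 = 1 \<and> p 2 = 2 \<and> p 3 = 3)"
    proof
      assume "p 1 = 1 \<and> p 2 = 2 \<and> p 3 = 3"
      then have "p x = id x" for x using out[of x] by (cases "x = 1 \<or> x = 2 \<or> x = 3") auto
      then show False using p by blast
    qed
    moreover have "\<not> (p 1 = 2 \<and> p 2 = 3 \<and> p 3 = 1)"
    proof
      assume "p 1 = 2 \<and> p 2 = 3 \<and> p 3 = 1"
      then have "p x = c x" for x
        using out[of x] by (cases "x = 1 \<or> x = 2 \<or> x = 3") (auto simp: c_def)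
      then show False using p by blast
    qed
    moreover have "\<not> (p 1 = 3 \<and> p 2 = 1 \<and> p 3 = 2)"
    proof
      assume "p 1 = 3 \<and> p 2 = 1 \<and> p 3 = 2"
      then have "p x = (c \<circ> c) x" for x
        using out[of x] by (cases "x = 1 \<or> x = 2 \<or> x = 3") (auto simp: c_def)
      then show False using p by blast
    qed
    ultimately have "p (p 1) = 1 \<and> p (p 2) = 2 \<and> p (p 3) = 3"
      by (elim insertE emptyE; simp)
    then have "(p \<circ> p) x = id x" for x
      using out[of x] by (cases "x = 1 \<or> x = 2 \<or> x = 3") auto
    then show "p \<otimes>\<^bsub>sym_group 3\<^esub> p = \<one>\<^bsub>sym_group 3\<^esub>" by (auto simp: sym_group_def)
  qed
  moreover have "S.cyc c \<noteq> carrier (sym_group 3)"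
  proof
    assume eq: "S.cyc c = carrier (sym_group 3)"
    have "card (carrier (sym_group 3)) = 6"
      using card_permutations[of "{1..3::nat}" 3] by (simp add: sym_group_def fact_numeral)
    moreover have "card (S.cyc c) = 3" using S.cyc_card[OF c] ord by simp
    ultimately show False using eq by simp
  qed
  ultimately show ?thesis using S.iso_dihedral_group[of c] ord by simp
qed

section \<open>Domination numbers of the recognised groups\<close>

context finite_group
begin

lemma ord_6_of_ord_2_ord_3:
  assumes u: "u \<in> carrier G" "u \<noteq> \<one>" "u \<otimes> u = \<one>" and z: "z \<in> carrier G" "ord z = 3"
    and comm: "u \<otimes> z = z \<otimes> u"
  shows "ord (u \<otimes> z) = 6"
proof -
  have uzG: "u \<otimes> z \<in> carrier G" using u z by simp
  have u2: "u [^] (2::nat) = \<one>" using u by (simp add: numeral_2_eq_2)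
  have z3: "z [^] (3::nat) = \<one>" using pow_ord_eq_1[OF z(1)] z(2) by simp
  have pow: "(u \<otimes> z) [^] n = u [^] n \<otimes> z [^] n" for n :: nat
    using pow_mult_distrib[OF comm u(1) z(1)] .
  have "(u \<otimes> z) [^] (2::nat) = z \<otimes> z"
    unfolding pow u2 using z by (simp add: numeral_2_eq_2)
  then have "(u \<otimes> z) [^] (2::nat) \<noteq> \<one>"
    using ord_3_facts(1,2)[OF z] z by simp
  then have n2: "\<not> ord (u \<otimes> z) dvd 2" using pow_eq_id[OF uzG] by simp
  have "(u \<otimes> z) [^] (3::nat) = u \<otimes> u \<otimes> u"
    unfolding pow z3 using u(1) by (simp add: numeral_3_eq_3)
  then have "(u \<otimes> z) [^] (3::nat) \<noteq> \<one>" using u by simp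
  then have n3: "\<not> ord (u \<otimes> z) dvd 3" using pow_eq_id[OF uzG] by simp
  have "u [^] (6::nat) = \<one>" "z [^] (6::nat) = \<one>"
    using u2 z3 u(1) z pow_eq_id[of u 2] pow_eq_id[of u 6] pow_eq_id[of z 6]
      dvd_trans[of "ord u" 2 6] by auto
  then have "(u \<otimes> z) [^] (6::nat) = \<one>" unfolding pow by simp
  then have d6: "ord (u \<otimes> z) dvd 6" using pow_eq_id[OF uzG] by simp
  then have "ord (u \<otimes> z) \<le> 6" by (rule dvd_imp_le) simp
  then have "ord (u \<otimes> z) \<in> {0, 1, 2, 3, 4, 5, 6}" by auto
  then show ?thesis using d6 n2 n3 by (elim insertE emptyE) simp_all
qed

lemma ord_4_facts:
  assumes "x \<in> carrier G" "ord x = 4"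
  shows "x \<otimes> x \<noteq> \<one>" "x \<otimes> x \<otimes> (x \<otimes> x) = \<one>" "x \<otimes> x \<noteq> x" "x \<otimes> x \<noteq> inv x" "inv x \<noteq> x"
proof -
  have dvd: "x [^] n = \<one> \<longleftrightarrow> 4 dvd n" for n :: nat using pow_eq_id[OF assms(1)] assms(2) by simp
  have "x [^] (2::nat) \<noteq> \<one>" unfolding dvd by simp
  then show sq: "x \<otimes> x \<noteq> \<one>" using assms(1) by (simp add: numeral_2_eq_2)
  show "x \<otimes> x \<otimes> (x \<otimes> x) = \<one>" using dvd[of 4] assms(1) by (simp add: eval_nat_numeral m_assoc)
  show "x \<otimes> x \<noteq> x" using sq assms(1) by auto
  show "x \<otimes> x \<noteq> inv x"
  proof
    assume "x \<otimes> x = inv x"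
    then have "x [^] (3::nat) = \<one>" using assms(1) by (simp add: numeral_3_eq_3)
    then show False using dvd by simp
  qed
  show "inv x \<noteq> x" using sq r_inv[OF assms(1)] by metis
qed

text \<open>
  An element \<open>x\<close> of order four normalises the only subgroup of order three, so the involution
  \<open>x \<otimes> x\<close> centralises it.
\<close>

lemma ord_6_of_ord_4_ord_3:
  assumes x: "x \<in> carrier G" "ord x = 4" and z: "z \<in> carrier G" "ord z = 3"
    and unique: "\<And>a. a \<in> carrier G \<Longrightarrow> ord a = 3 \<Longrightarrow> a \<in> cyc z"
  obtains u where "u \<in> carrier G" "ord u = 6"
proof -
  have "conj x z \<in> cyc z" using unique ord_conj x z by simp
  then have "conj x (conj x z) = z" using square_centralizes_ord_3 x z by blast
  then have "conj (x \<otimes> x) z = z" using x z by (simp only: conj_mult)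
  then have "x \<otimes> x \<otimes> z = z \<otimes> (x \<otimes> x)" using conj_eq_self_iff[of "x \<otimes> x" z] x z by simp
  then have "ord (x \<otimes> x \<otimes> z) = 6"
    using ord_6_of_ord_2_ord_3[of "x \<otimes> x" z] ord_4_facts[OF x] x z by simp
  then show thesis using that[of "x \<otimes> x \<otimes> z"] x z by simp
qed

lemma involution_iff:
  "x \<in> carrier G \<Longrightarrow> x \<otimes> x = \<one> \<longleftrightarrow> ord x = 1 \<or> ord x = 2"
proof -
  assume x: "x \<in> carrier G"
  have "x \<otimes> x = \<one> \<longleftrightarrow> x [^] (2::nat) = \<one>" using x by (simp add: numeral_2_eq_2)
  also have "\<dots> \<longleftrightarrow> ord x dvd 2" using pow_eq_id x by simp
  also have "\<dots> \<longleftrightarrow> ord x = 1 \<or> ord x = 2" using two_is_prime_nat by (auto simp: prime_nat_iff)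
  finally show ?thesis .
qed

end

context trivial_cyclicizer_group
begin

text \<open>
  A cyclic subgroup that contains \<open>t\<close> is generated outside \<open>cyc c\<close>, hence has order two.
\<close>

lemma rotation_outside_isolated:
  assumes c: "rotation c" and t: "t \<in> carrier G" "t \<notin> cyc c"
  shows "isolated t"
proof -
  have cG: "c \<in> carrier G" using c by (simp add: rotation_def)
  have "v = t" if v: "v \<in> V" "cocyclic t v" for v
  proof -
    obtain g where g: "g \<in> carrier G" "t \<in> cyc g" "v \<in> cyc g" using v(2) cocyclic_def by blast
    have "g \<notin> cyc c" using cyc_mono[OF cG] g(2) t(2) by blast
    then have "g \<otimes> g = \<one>" using c g(1) by (simp add: rotation_def)
    then have "ord g \<le> 2" using involution_iff[OF g(1)] by auto
    have "a = g" if a: "a \<in> cyc g" "a \<noteq> \<one>" for a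
    proof -
      obtain k :: nat where "k < ord g" "a = g [^] k" using cyc_natE a(1) g(1) by metis
      then have "k = 0 \<or> k = 1" "a = g [^] k" using \<open>ord g \<le> 2\<close> by auto
      then show ?thesis using a(2) g(1) by auto
    qed
    moreover have "t \<noteq> \<one>" using t(2) cyc_one by metis
    ultimately show ?thesis using g v(1) by blast
  qed
  then show ?thesis using t cyc_one by (auto simp: isolated_def)
qed

text \<open>
  In the complement, the elements outside \<open>cyc c\<close> are isolated and belong to every dominating
  set; the remaining vertices form a component that \<open>c\<close> dominates. Truncated subtraction
  makes the formula correct for \<open>c = \<one>\<close> as well, where this component is empty.
\<close>

lemma rotation_domination_numbers:
  assumes c: "rotation c"
  shows "\<gamma> = 1" "\<gamma>' + (ord c - 2) + 1 = order G"
proof -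
  have cG: "c \<in> carrier G" using c by (simp add: rotation_def)
  show "\<gamma> = 1"
    using cyc_proper[OF cG] rotation_outside_isolated[OF c] \<gamma>_eq_1_if_isolated by metis
  obtain D where D: "D \<subseteq> V" "\<And>v. v \<in> V - D \<Longrightarrow> \<exists>d\<in>D. cocyclic v d" "card D = \<gamma>'"
    using \<gamma>'_attained by blast
  have finD: "finite D" using D(1) by (rule finite_subset_V)
  have out: "carrier G - cyc c \<subseteq> D"
  proof
    fix t assume t: "t \<in> carrier G - cyc c"
    then have iso: "isolated t" using rotation_outside_isolated[OF c] by blast
    show "t \<in> D"
    proof (rule ccontr)
      assume "t \<notin> D"
      then obtain d where "d \<in> D" "cocyclic t d" using D(2) iso unfolding isolated_def by blast
      then show False using iso D(1) \<open>t \<notin> D\<close> unfolding isolated_def by blast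
    qed
  qed
  have card_out: "card (carrier G - cyc c) + ord c = order G"
    using card_Diff_subset[OF cyc_finite[OF cG] cyc_subset_carrier[OF cG]]
      card_mono[OF finite_carrier cyc_subset_carrier[OF cG]] cyc_card[OF cG]
    by (simp add: order_def)
  show "\<gamma>' + (ord c - 2) + 1 = order G"
  proof (cases "c = \<one>")
    case True
    then have "ord c = 1" by simp
    have "\<gamma>' \<le> card V" by (rule \<gamma>'_le) auto
    moreover have "card (carrier G - cyc c) \<le> card D" using out finD card_mono by blast
    ultimately show ?thesis using card_out card_V D(3) \<open>ord c = 1\<close> by simp
  next
    case False
    then have cV: "c \<in> V" using cG by simp
    have "ord c \<noteq> 1" using ord_eq_1 cG False by blast
    then have "ord c \<ge> 2" using ord_pos[OF cG] by linarith
    have "\<gamma>' + (ord c - 2) + 1 \<le> order G" using spares_bound[OF spares_cyc[OF cV]] .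
    moreover obtain d where d: "d \<in> D" "d \<in> cyc c"
    proof (cases "c \<in> D")
      case False
      then obtain d where d: "d \<in> D" "cocyclic c d" using D(2) cV by blast
      have "d \<in> cyc c"
      proof (rule ccontr)
        assume "d \<notin> cyc c"
        then have "isolated d" using rotation_outside_isolated[OF c] d(1) D(1) by blast
        then have "c = d" using d(2) cocyclic_sym cV unfolding isolated_def by blast
        then show False using \<open>d \<notin> cyc c\<close> by simp
      qed
      then show thesis using that d by blast
    qed (use that in simp)
    moreover have "card (insert d (carrier G - cyc c)) = card (carrier G - cyc c) + 1"
      using d(2) by simp
    moreover have "card (insert d (carrier G - cyc c)) \<le> card D"
      using out d(1) by (intro card_mono[OF finD]) auto
    ultimately show ?thesis using card_out D(3) \<open>ord c \<ge> 2\<close> by linarith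
  qed
qed

text \<open>
  The complement consists of the four disjoint edges \<open>{a, inv a}\<close>, one for each subgroup of order
  three; a dominating set contains an end of each. The non-cyclic graph is complete
  multipartite with these four parts, so two vertices from different parts dominate it, but one
  vertex does not.
\<close>

lemma exponent_3_domination_numbers:
  assumes exp3: "\<And>a. a \<in> carrier G \<Longrightarrow> a \<noteq> \<one> \<Longrightarrow> ord a = 3" and order: "order G = 9"
  shows "\<gamma> = 2" "\<gamma>' = 4"
proof -
  have cocyclic: "b = a \<or> b = inv a" if ab: "a \<in> V" "b \<in> V" "cocyclic a b" for a b
  proof -
    obtain g where g: "g \<in> carrier G" "a \<in> cyc g" "b \<in> cyc g" using ab(3) cocyclic_def by blast
    have "g \<noteq> \<one>" using g ab(1) generate_one by auto
    then have "cyc g = {\<one>, g, inv g}" using ord_3_facts(4) exp3 g(1) by blast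
    then show ?thesis using g ab by auto
  qed
  have inv_ne: "inv a \<noteq> a" if "a \<in> V" for a using exp3 ord_3_facts(3) that by blast
  obtain x where x: "x \<in> V" using V_nonempty by blast
  have ox: "ord x = 3" using x exp3 by blast
  have max: "maximal_cyclic x"
    unfolding maximal_cyclic_def
  proof (intro conjI ballI impI)
    fix g assume g: "g \<in> carrier G" "x \<in> cyc g"
    have "g \<noteq> \<one>" using g x generate_one by auto
    then show "g \<in> cyc x" using ord_3_mem_sym[of x g] exp3 g x by simp
  qed (use x in simp)
  have "prime_factors (3::nat) = {3}" by (rule prime_prime_factors) simp
  then have "\<gamma> \<le> 2" using \<gamma>_le_maximal[OF max] x ox by simp
  moreover have "\<gamma> \<noteq> 1"
  proof
    assume "\<gamma> = 1"
    then obtain D where D: "D \<subseteq> V" "\<And>v. v \<in> V - D \<Longrightarrow> \<exists>d\<in>D. \<not> cocyclic v d" "card D = 1"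
      using \<gamma>_attained by metis
    then obtain a where a: "D = {a}" using card_1_singletonE by metis
    then have "inv a \<in> V - D" using D(1) inv_ne inv_eq_1_iff by auto
    then have "\<not> cocyclic (inv a) a" using D(2) a by blast
    moreover have "cocyclic a (inv a)" using a D(1) cocyclic_mem cyc_inv by simp
    ultimately show False using cocyclic_sym by blast
  qed
  ultimately show "\<gamma> = 2" using \<gamma>_pos by linarith
  obtain y where y: "y \<in> carrier G" "y \<notin> cyc x" using cyc_proper x by blast
  have "y \<noteq> \<one>" using y(2) cyc_one by metis
  then have "spares {a \<in> carrier G. ord a = 3} 4" using spares_ord_3[of x y] x y exp3 by simp
  then have "\<gamma>' \<le> 4" using spares_bound order by fastforce
  moreover have "8 \<le> 2 * \<gamma>'"
  proof -
    obtain D where D: "D \<subseteq> V" "\<And>v. v \<in> V - D \<Longrightarrow> \<exists>d\<in>D. cocyclic v d" "card D = \<gamma>'"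
      using \<gamma>'_attained by blast
    have finD: "finite D" using D(1) by (rule finite_subset_V)
    have "V \<subseteq> D \<union> m_inv G ` D"
    proof
      fix v assume v: "v \<in> V"
      show "v \<in> D \<union> m_inv G ` D"
      proof (cases "v \<in> D")
        case False
        then obtain d where d: "d \<in> D" "cocyclic v d" using D(2) v by blast
        then have "cocyclic d v" "d \<in> V" using cocyclic_sym D(1) by auto
        then have "v = inv d" using cocyclic v d(1) False by blast
        then show ?thesis using d(1) by blast
      qed simp
    qed
    then have "card V \<le> card (D \<union> m_inv G ` D)" using finD by (intro card_mono) auto
    also have "\<dots> \<le> card D + card (m_inv G ` D)" by (rule card_Un_le)
    also have "\<dots> \<le> card D + card D" using card_image_le[OF finD] by simp
    finally show ?thesis using card_V order D(3) by simp
  qed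
  ultimately show "\<gamma>' = 4" by linarith
qed

section \<open>Groups with a large sum of domination numbers\<close>

lemma spares_cyc_inverse:
  assumes "x \<in> V" "y \<in> carrier G" "y \<notin> cyc x" "y \<otimes> y \<noteq> \<one>"
  shows "spares ((cyc x - {\<one>}) \<union> {y, inv y}) (ord x - 2 + 1)"
proof (rule spares_Un)
  show "spares (cyc x - {\<one>}) (ord x - 2)" using spares_cyc assms(1) .
  have "inv y \<noteq> y" using assms(2,4) r_inv by metis
  then show "spares {y, inv y} 1" using spares_inverse assms(2) by blast
  show "(cyc x - {\<one>}) \<inter> {y, inv y} = {}" using cyc_inv_iff[of x y] assms by auto
qed

lemma spares_ord_4_pair:
  assumes x: "x \<in> carrier G" "ord x = 4" and y: "y \<in> carrier G" "ord y = 4"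
    and xy: "x \<otimes> x \<notin> cyc y"
  shows "spares ((cyc x - {\<one>}) \<union> (cyc y - {\<one>})) 4"
proof -
  have V: "x \<in> V" "y \<in> V" using x y by auto
  have "a = \<one>" if a: "a \<in> cyc x" "a \<in> cyc y" for a
  proof (rule ccontr)
    assume "a \<noteq> \<one>"
    obtain k :: nat where k: "k < 4" "a = x [^] k" using cyc_natE a(1) x by metis
    then have "k \<noteq> 0" using \<open>a \<noteq> \<one>\<close> nat_pow_0 by metis
    then have "k = 1 \<or> k = 2 \<or> k = 3" using k(1) by auto
    moreover have "a \<otimes> a = x [^] (k + k)" using k(2) x(1) by (simp add: nat_pow_mult)
    moreover have "x [^] (6::nat) = x [^] (4::nat) \<otimes> x [^] (2::nat)" using x(1) by (simp add: nat_pow_mult)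
    moreover have "x [^] (4::nat) = \<one>" using pow_ord_eq_1[OF x(1)] x(2) by simp
    moreover have "x [^] (2::nat) = x \<otimes> x" using x(1) by (simp add: numeral_2_eq_2)
    ultimately have "x [^] (2::nat) = a \<or> x [^] (2::nat) = a \<otimes> a"
      using k(2) x(1) by (elim disjE) simp_all
    then have "x [^] (2::nat) \<in> cyc y" using a(2) cyc_mult[OF y(1)] by metis
    then show False using xy x(1) by (simp add: numeral_2_eq_2)
  qed
  then have "(cyc x - {\<one>}) \<inter> (cyc y - {\<one>}) = {}" by blast
  then have "spares ((cyc x - {\<one>}) \<union> (cyc y - {\<one>})) ((ord x - 2) + (ord y - 2))"
    using spares_Un spares_cyc V by blast
  then show ?thesis using x y by simp
qed

text \<open>
  The common square of \<open>x\<close> and \<open>y\<close> dominates \<open>x\<close>, \<open>y\<close> and their inverses.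
\<close>

lemma spares_ord_4_common_square:
  assumes x: "x \<in> carrier G" "ord x = 4" and y: "y \<in> carrier G" "ord y = 4"
    and xy: "x \<otimes> x \<in> cyc y" "y \<notin> cyc x"
  shows "spares V 4"
  unfolding spares_def
proof (intro exI conjI)
  let ?R = "{x, inv x, y, inv y}" and ?u = "x \<otimes> x"
  have u: "?u \<in> cyc x" using cyc_mult[OF x(1)] by simp
  have yx: "inv y \<notin> cyc x" using cyc_inv_iff[OF x(1) y(1)] xy(2) by simp
  show R: "?R \<subseteq> V" using x y by auto
  show D: "{?u} \<subseteq> V" using x ord_4_facts(1)[OF x] by simp
  show "?R \<union> {?u} \<subseteq> V" using R D by simp
  have "y \<noteq> ?u" "inv y \<noteq> ?u" using u xy(2) yx by metis+
  then show "?R \<inter> {?u} = {}" using ord_4_facts(3,4)[OF x] by auto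
  have "cocyclic r ?u" if "r \<in> {x, inv x}" for r
    unfolding cocyclic_def using u cyc_inv[OF x(1) cyc_self] x(1) that by (intro bexI[of _ x]) auto
  moreover have "cocyclic r ?u" if "r \<in> {y, inv y}" for r
    unfolding cocyclic_def using xy(1) cyc_inv[OF y(1) cyc_self] y(1) that
    by (intro bexI[of _ y]) auto
  ultimately show "\<forall>r\<in>?R. \<exists>d\<in>{?u}. cocyclic r d" by simp
  have "x \<noteq> y" "x \<noteq> inv y" "inv x \<noteq> y" "inv x \<noteq> inv y"
    using xy(2) yx cyc_inv[OF x(1) cyc_self] cyc_self[of x] by metis+
  then show "card ?R = 4" using ord_4_facts(5)[OF x] ord_4_facts(5)[OF y] by auto
qed

text \<open>
  Take \<open>x\<close> of the largest order, which is at most five as \<open>cyc x\<close> alone saves \<open>ord x - 2\<close>. An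
  element \<open>t\<close> outside \<open>cyc x\<close> with \<open>t \<otimes> t \<noteq> \<one>\<close> leads to a saving of four: from \<open>cyc x\<close> and \<open>t\<close>
  if the order of \<open>x\<close> is five, from two subgroups of order three, or from two subgroups of
  order four, whether or not they share their involution. What is left is \<open>x\<close> of order four
  and \<open>t\<close> of order three, where \<open>cyc t\<close> is the only subgroup of order three and an element of
  order six arises.
\<close>

lemma rotation_if_spares_le_3:
  assumes bound: "\<And>T k. spares T k \<Longrightarrow> k \<le> 3"
  obtains c where "rotation c" "ord c \<in> {1, 3, 4, 5}"
proof -
  have le5: "ord a \<le> 5" if "a \<in> carrier G" for a
  proof (cases "a = \<one>")
    case False
    then show ?thesis using bound[OF spares_cyc[of a]] that by simp
  qed simp
  have ord_3_unique: "b \<in> cyc a"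
    if "a \<in> carrier G" "ord a = 3" "b \<in> carrier G" "ord b = 3" for a b
    using bound[OF spares_ord_3[of a b]] that by fastforce
  consider (five) x where "x \<in> carrier G" "ord x = 5"
    | (four) x where "x \<in> carrier G" "ord x = 4" "\<forall>a\<in>carrier G. ord a \<noteq> 5"
    | (three) x where "x \<in> carrier G" "ord x = 3" "\<forall>a\<in>carrier G. ord a \<noteq> 4 \<and> ord a \<noteq> 5"
    | (two) "\<forall>a\<in>carrier G. ord a \<noteq> 3 \<and> ord a \<noteq> 4 \<and> ord a \<noteq> 5"
    by metis
  then show thesis
  proof cases
    case five
    have "x \<in> V" using five by auto
    then have "t \<otimes> t = \<one>" if "t \<in> carrier G" "t \<notin> cyc x" for t
      using bound[OF spares_cyc_inverse[of x t]] five that by fastforce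
    then show thesis using that[of x] five by (simp add: rotation_def)
  next
    case four
    have "t \<otimes> t = \<one>" if t: "t \<in> carrier G" "t \<notin> cyc x" for t
    proof (rule ccontr)
      assume "t \<otimes> t \<noteq> \<one>"
      then have "ord t \<noteq> 1" "ord t \<noteq> 2" using involution_iff t(1) by auto
      moreover have "ord t \<noteq> 5" "ord t \<le> 5" "ord t > 0" using four(3) le5 t(1) by auto
      ultimately consider "ord t = 3" | "ord t = 4" by linarith
      then show False
      proof cases
        case 1
        obtain u where "u \<in> carrier G" "ord u = 6"
          using ord_6_of_ord_4_ord_3[OF four(1,2) t(1) 1] ord_3_unique[OF t(1) 1] by blast
        then show ?thesis using le5 by fastforce
      next
        case 2
        then have "spares ((cyc x - {\<one>}) \<union> (cyc t - {\<one>})) 4 \<or> spares V 4"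
          using spares_ord_4_pair spares_ord_4_common_square four t by blast
        then show ?thesis using bound by fastforce
      qed
    qed
    then show thesis using that[of x] four by (simp add: rotation_def)
  next
    case three
    have "t \<otimes> t = \<one>" if t: "t \<in> carrier G" "t \<notin> cyc x" for t
    proof (rule ccontr)
      assume "t \<otimes> t \<noteq> \<one>"
      then have "ord t \<noteq> 1" "ord t \<noteq> 2" using involution_iff t(1) by auto
      moreover have "ord t \<noteq> 4" "ord t \<noteq> 5" "ord t \<le> 5" "ord t > 0" using three(3) le5 t(1) by auto
      ultimately have "ord t = 3" by linarith
      then show False using ord_3_unique three(1,2) t by blast
    qed
    then show thesis using that[of x] three by (simp add: rotation_def)
  next
    case two
    have "t \<otimes> t = \<one>" if t: "t \<in> carrier G" for t
    proof -
      have "ord t \<noteq> 3" "ord t \<noteq> 4" "ord t \<noteq> 5" "ord t \<le> 5" "ord t > 0" using two le5 t by auto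
      then have "ord t = 1 \<or> ord t = 2" by linarith
      then show ?thesis using involution_iff t by blast
    qed
    then show thesis using that[of \<one>] by (simp add: rotation_def)
  qed
qed

text \<open>
  A composite \<open>k \<ge> 5\<close> is divisible neither by \<open>k - 1\<close> nor by \<open>k - 2\<close>, so its prime
  divisors lie between 2 and \<open>k - 3\<close>, which allows only \<open>k - 4\<close> of them.
\<close>

lemma prime_factors_few:
  assumes "3 \<le> k" "k \<le> card (prime_factors k) + 3"
  shows "k = 3 \<or> k = (4::nat)"
proof (rule ccontr)
  assume "\<not> ?thesis"
  then have k: "k \<ge> 5" using assms(1) by linarith
  show False
  proof (cases "Factorial_Ring.prime k")
    case True
    then show ?thesis using prime_prime_factors[OF True] assms(2) k by simp
  next
    case False
    have "prime_factors k \<subseteq> {2..k - 3}"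
    proof
      fix p assume "p \<in> prime_factors k"
      then have p: "Factorial_Ring.prime p" "p dvd k" by auto
      have "p \<le> k" using p(2) k by (simp add: dvd_imp_le)
      moreover have "p \<noteq> k" using p(1) False by blast
      moreover have "p \<noteq> k - 1"
      proof
        assume "p = k - 1"
        then have "k - p = 1" using k by simp
        moreover have "p dvd k - p" using p(2) by (simp add: dvd_diff_nat)
        ultimately show False using p(1) by simp
      qed
      moreover have "p \<noteq> k - 2"
      proof
        assume "p = k - 2"
        then have "k - p = 2" using k by simp
        moreover have "p dvd k - p" using p(2) by (simp add: dvd_diff_nat)
        ultimately have "p \<le> 2" using dvd_imp_le[of p 2] by simp
        then show False using \<open>p = k - 2\<close> k by simp
      qed
      moreover have "p \<ge> 2" using p(1) prime_ge_2_nat by blast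
      ultimately show "p \<in> {2..k - 3}" by simp
    qed
    then have "card (prime_factors k) \<le> card {2..k - 3}" by (rule card_mono[rotated]) simp
    then show ?thesis using assms(2) k by simp
  qed
qed

text \<open>
  For a maximal cyclic subgroup of order \<open>k\<close>, generators of two further maximal cyclic subgroups
  add two to the saving \<open>k - 2\<close>. Hence \<open>k \<le> \<gamma> + 2\<close>, while \<open>\<gamma>\<close> is at most one more than the number
  of primes dividing \<open>k\<close>. Thus \<open>k\<close> is 3 or 4, which gives \<open>\<gamma> = 2\<close>, and no saving exceeds four.

  If \<open>x\<close> had order four, some maximal cyclic subgroup \<open>cyc z\<close> would avoid the involution \<open>x \<otimes> x\<close>,
  because this involution is not in the cyclicizer. If \<open>z\<close> has order four, \<open>x\<close>, \<open>z\<close> and a third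
  maximal cyclic subgroup save five. If \<open>z\<close> has order three, either a second subgroup of order three
  raises the saving to six, or there is an element of order six.

  So all non-identity elements have order three. Four subgroups of order three already save four, so
  they cover the group, which therefore has at most nine elements.
\<close>

lemma iso_Z3_Z3_if_spares_le:
  assumes \<gamma>2: "\<gamma> \<noteq> 1" and bound: "\<And>T k. spares T k \<Longrightarrow> k \<le> \<gamma> + 2"
  shows "G \<cong> integer_mod_group 3 \<times>\<times> integer_mod_group 3"
proof -
  \<comment> \<open>A maximal cyclic subgroup of order two would give an isolated vertex and \<open>\<gamma> = 1\<close>.\<close>
  have not_involution: "x \<otimes> x \<noteq> \<one>" if "maximal_cyclic x" "x \<noteq> \<one>" for x
  proof
    assume "x \<otimes> x = \<one>"
    moreover have xG: "x \<in> carrier G" using that(1) by (simp add: maximal_cyclic_def)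
    ultimately have "ord x = 2" using involution_iff ord_eq_1 that(2) by blast
    then show False using maximal_involution_isolated \<gamma>_eq_1_if_isolated that(1) \<gamma>2 by blast
  qed
  have outside_spares: "spares {z, inv z} 1" if "maximal_cyclic z" "z \<notin> cyc x" for x z
  proof -
    have zG: "z \<in> carrier G" using that(1) by (simp add: maximal_cyclic_def)
    have "z \<noteq> \<one>" using that(2) cyc_one by metis
    then have "inv z \<noteq> z" using not_involution[OF that(1)] r_inv[OF zG] by metis
    then show ?thesis using spares_inverse zG by blast
  qed
  have ord_max: "(ord x = 3 \<or> ord x = 4) \<and> \<gamma> \<le> 2" if x: "maximal_cyclic x" "x \<noteq> \<one>" for x
  proof -
    have xG: "x \<in> carrier G" using x by (simp add: maximal_cyclic_def)
    have ge3: "ord x \<ge> 3"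
      using not_involution[OF x] involution_iff[OF xG] ord_pos[OF xG] by linarith
    obtain z w where zw: "maximal_cyclic z" "maximal_cyclic w"
        "z \<notin> cyc x" "w \<notin> cyc x" "w \<notin> cyc z"
      using three_maximal_cyclic[OF x(1)] by blast
    have zG: "z \<in> carrier G" and wG: "w \<in> carrier G" using zw by (auto simp: maximal_cyclic_def)
    have "z \<noteq> \<one>" using zw(3) cyc_one by metis
    then have "spares ((cyc x - {\<one>}) \<union> {z, inv z}) (ord x - 2 + 1)"
      using spares_cyc_inverse not_involution[OF zw(1)] x xG zG zw(3) by simp
    moreover have "((cyc x - {\<one>}) \<union> {z, inv z}) \<inter> {w, inv w} = {}"
      using cyc_inv_iff[OF xG wG] cyc_inv_iff[OF zG wG] cyc_inv[OF zG cyc_self] cyc_self[of z] zw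
        zG wG by auto
    ultimately have "spares (((cyc x - {\<one>}) \<union> {z, inv z}) \<union> {w, inv w}) (ord x - 2 + 1 + 1)"
      using spares_Un outside_spares[OF zw(2,4)] by blast
    then have "ord x - 2 + 1 + 1 \<le> \<gamma> + 2" by (rule bound)
    then have "ord x \<le> \<gamma> + 2" using ge3 by linarith
    then have "ord x \<le> card (prime_factors (ord x)) + 3" using \<gamma>_le_maximal[OF x] by linarith
    then have k: "ord x = 3 \<or> ord x = 4" using prime_factors_few ge3 by blast
    have "prime_factors (3::nat) = {3}" by (rule prime_prime_factors) simp
    moreover have "prime_factors (4::nat) = {2}"
      using prime_factorization_prime_power[OF two_is_prime_nat, of 2] by simp
    ultimately have "card (prime_factors (ord x)) = 1" using k by auto
    then show ?thesis using k \<gamma>_le_maximal[OF x] by simp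
  qed
  have above: "\<exists>m. maximal_cyclic m \<and> m \<noteq> \<one> \<and> v \<in> cyc m" if "v \<in> V" for v
  proof -
    have "v \<in> carrier G" using that by blast
    then obtain m where "maximal_cyclic m" "v \<in> cyc m" by (rule maximal_cyclic_above)
    moreover have "m \<noteq> \<one>" if "v \<in> cyc m" for m
      using that \<open>v \<in> V\<close> generate_one by (metis DiffD2)
    ultimately show ?thesis by blast
  qed
  have "\<gamma> = 2"
  proof -
    obtain v where "v \<in> V" using V_nonempty by blast
    then obtain m where "maximal_cyclic m" "m \<noteq> \<one>" using above by metis
    then have "\<gamma> \<le> 2" using ord_max by metis
    then show ?thesis using \<gamma>2 \<gamma>_pos by linarith
  qed
  then have bound4: "k \<le> 4" if "spares T k" for T k using bound that by fastforce
  have ords: "ord v dvd 3 \<or> ord v dvd 4" if "v \<in> carrier G" for v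
  proof (cases "v = \<one>")
    case False
    then obtain m where m: "maximal_cyclic m" "m \<noteq> \<one>" "v \<in> cyc m"
      using above[of v] \<open>v \<in> carrier G\<close> by auto
    then have "ord v dvd ord m" using ord_dvd_of_mem_cyc by (simp add: maximal_cyclic_def)
    then show ?thesis using ord_max[OF m(1,2)] by auto
  qed simp
  have not_6: "ord v \<noteq> 6" if "v \<in> carrier G" for v using ords[OF that] by auto
  have not_4: "ord x \<noteq> 4" if xG: "x \<in> carrier G" for x
  proof
    assume x4: "ord x = 4"
    have "x \<otimes> x \<in> V" using xG ord_4_facts(1) x4 by simp
    then obtain g where g: "g \<in> V" "\<not> cocyclic (x \<otimes> x) g" using exists_not_cocyclic by blast
    obtain z where z: "maximal_cyclic z" "z \<noteq> \<one>" "g \<in> cyc z" using above g(1) by blast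
    have zG: "z \<in> carrier G" using z(1) by (simp add: maximal_cyclic_def)
    have xxz: "x \<otimes> x \<notin> cyc z" using g(2) z(3) zG unfolding cocyclic_def by blast
    have "ord z = 3 \<or> ord z = 4" using ord_max z by blast
    then show False
    proof
      assume z3: "ord z = 3"
      have "a \<in> cyc z" if a: "a \<in> carrier G" "ord a = 3" for a
      proof (rule ccontr)
        assume "a \<notin> cyc z"
        then have "spares {a \<in> carrier G. ord a = 3} 4" using spares_ord_3[OF zG z3 a] by blast
        moreover have "spares (cyc x - {\<one>}) 2" using spares_cyc[of x] xG x4 by fastforce
        moreover have "{a \<in> carrier G. ord a = 3} \<inter> (cyc x - {\<one>}) = {}"
          using ord_dvd_of_mem_cyc[OF xG] x4 by fastforce
        ultimately have "spares ({a \<in> carrier G. ord a = 3} \<union> (cyc x - {\<one>})) (4 + 2)"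
          by (rule spares_Un)
        then show False using bound4 by fastforce
      qed
      then obtain u where "u \<in> carrier G" "ord u = 6"
        using ord_6_of_ord_4_ord_3[OF xG x4 zG z3] by blast
      then show False using not_6 by blast
    next
      assume z4: "ord z = 4"
      have xz: "x \<notin> cyc z" using xxz cyc_mult[OF zG] by blast
      have "cyc z \<noteq> cyc x" using xz cyc_self by metis
      moreover have "cyc z = cyc x" if "z \<in> cyc x"
        by (rule cyc_eq_if_ord_le[OF xG that]) (simp add: x4 z4)
      ultimately have zx: "z \<notin> cyc x" by metis
      obtain w where w: "maximal_cyclic w" "w \<notin> cyc x" "w \<notin> cyc z"
        using third_maximal_cyclic[OF xG zG xz zx] by blast
      have wG: "w \<in> carrier G" using w(1) by (simp add: maximal_cyclic_def)
      have "((cyc x - {\<one>}) \<union> (cyc z - {\<one>})) \<inter> {w, inv w} = {}"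
        using cyc_inv_iff[OF xG wG] cyc_inv_iff[OF zG wG] w by auto
      then have "spares (((cyc x - {\<one>}) \<union> (cyc z - {\<one>})) \<union> {w, inv w}) (4 + 1)"
        using spares_Un spares_ord_4_pair[OF xG x4 zG z4 xxz] outside_spares[OF w(1,2)] by blast
      then show False using bound4 by fastforce
    qed
  qed
  have exp3: "ord v = 3" if v: "v \<in> carrier G" "v \<noteq> \<one>" for v
  proof -
    obtain m where m: "maximal_cyclic m" "m \<noteq> \<one>" "v \<in> cyc m" using above v by blast
    have mG: "m \<in> carrier G" using m(1) by (simp add: maximal_cyclic_def)
    have "ord m = 3" using ord_max[OF m(1,2)] not_4[OF mG] by blast
    then have "ord v dvd 3" using ord_dvd_of_mem_cyc[OF mG m(3)] by simp
    moreover have "Factorial_Ring.prime (3::nat)" by simp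
    ultimately show ?thesis using ord_eq_1[OF v(1)] v(2) by (metis prime_nat_iff)
  qed
  obtain x where x: "x \<in> carrier G" "x \<noteq> \<one>" using V_nonempty by blast
  obtain y where y: "y \<in> carrier G" "y \<notin> cyc x" using cyc_proper x(1) by blast
  have "y \<noteq> \<one>" using y(2) cyc_one by metis
  then have ox: "ord x = 3" and oy: "ord y = 3" using exp3 x y by auto
  obtain z w where zw: "z \<in> carrier G" "ord z = 3" "w \<in> carrier G" "ord w = 3"
    "z \<notin> cyc x" "z \<notin> cyc y" "w \<notin> cyc x" "w \<notin> cyc y" "w \<notin> cyc z"
    using four_subgroups_ord_3[OF x(1) ox y(1) oy y(2)] by blast
  let ?U = "cyc x \<union> cyc y \<union> cyc z \<union> cyc w"
  have U: "spares (?U - {\<one>}) 4" using spares_four_subgroups x ox y oy zw by blast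
  have "carrier G \<subseteq> ?U"
  proof (rule ccontr)
    assume "\<not> carrier G \<subseteq> ?U"
    then obtain v where v: "v \<in> carrier G" "v \<notin> ?U" by blast
    then have "v \<noteq> \<one>" using cyc_one by blast
    then have "inv v \<noteq> v" using exp3 ord_3_facts(3) v(1) by blast
    then have "spares {v, inv v} 1" using spares_inverse v(1) by blast
    moreover have "(?U - {\<one>}) \<inter> {v, inv v} = {}"
      using cyc_inv_iff[OF _ v(1)] v x y zw by auto
    ultimately have "spares ((?U - {\<one>}) \<union> {v, inv v}) (4 + 1)" using spares_Un U by blast
    then show False using bound4 by fastforce
  qed
  also have "?U \<subseteq> set [\<one>, x, inv x, y, inv y, z, inv z, w, inv w]"
    using ord_3_facts(4) x(1) ox y(1) oy zw by auto
  finally have "order G \<le> card (set [\<one>, x, inv x, y, inv y, z, inv z, w, inv w])"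
    unfolding order_def by (rule card_mono[rotated]) simp
  also have "\<dots> \<le> 9" using card_length[of "[\<one>, x, inv x, y, inv y, z, inv z, w, inv w]"] by simp
  finally show ?thesis using iso_Z3_Z3[OF exp3 _ x(1) ox y(1) oy y(2)] by blast
qed

lemma large_sum_cases:
  assumes "\<gamma> + \<gamma>' + 3 \<ge> order G"
  shows "elementary_abelian_group 2 G \<or> G \<cong> dihedral_group 3 \<or> G \<cong> dihedral_group 4 \<or>
    G \<cong> dihedral_group 5 \<or> G \<cong> integer_mod_group 3 \<times>\<times> integer_mod_group 3"
proof -
  have bound: "k \<le> \<gamma> + 2" if "spares T k" for T k
    using spares_bound[OF that] assms by linarith
  show ?thesis
  proof (cases "\<gamma> = 1")
    case True
    then have "k \<le> 3" if "spares T k" for T k using bound[OF that] by simp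
    then obtain c where c: "rotation c" "ord c \<in> {1, 3, 4, 5}" using rotation_if_spares_le_3 by blast
    have cG: "c \<in> carrier G" using c(1) by (simp add: rotation_def)
    show ?thesis
    proof (cases "ord c = 1")
      case True
      then have "c = \<one>" using ord_eq_1[OF cG] by blast
      then have "cyc c = {\<one>}" using generate_one by simp
      then have "\<forall>x\<in>carrier G - {\<one>}. x \<otimes> x = \<one>" using c(1) unfolding rotation_def by metis
      then have "\<forall>x\<in>carrier G. x \<otimes> x = \<one>" by force
      then show ?thesis using elementary_abelian_2_iff by blast
    next
      case False
      then have ge3: "ord c \<ge> 3" using c(2) by auto
      have "cyc c \<noteq> carrier G" using cyc_proper[OF cG] by metis
      then show ?thesis using iso_dihedral_group[OF c(1) ge3] c(2) False by auto
    qed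
  qed (use iso_Z3_Z3_if_spares_le bound in blast)
qed

lemma elementary_abelian_2_sum:
  assumes "elementary_abelian_group 2 G"
  shows "\<gamma> + \<gamma>' = order G"
proof -
  have "rotation \<one>" using assms by (simp add: rotation_def elementary_abelian_2_iff)
  then show ?thesis using rotation_domination_numbers[of \<one>] by simp
qed

lemma dihedral_group_sum:
  assumes "G \<cong> dihedral_group m" "m \<ge> 2"
  shows "\<gamma> + \<gamma>' + (m - 2) = order G"
proof -
  obtain c where "rotation c" "ord c = m" using dihedral_group_rotation[OF assms(1)] assms(2) by auto
  then show ?thesis using rotation_domination_numbers[of c] by simp
qed

lemma Z3_Z3_sum:
  assumes "G \<cong> integer_mod_group 3 \<times>\<times> integer_mod_group 3"
  shows "\<gamma> + \<gamma>' + 3 = order G"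
  using exponent_3_domination_numbers Z3_Z3_exponent[OF assms] by simp

end

theorem theorem12:
  fixes G :: "('a, 'b) monoid_scheme" and n :: nat
  assumes "group G"
    and "finite (carrier G)"
    and "order G = n"
    and "\<not> locally_cyclic G"
    and "card (cyclicizer G) = 1"
  shows
    "(int (domination_number (noncyclic_graph G)) +
      int (domination_number (graph_complement (noncyclic_graph G))) = int n
        \<longleftrightarrow> elementary_abelian_group 2 G) \<and>
     (int (domination_number (noncyclic_graph G)) +
      int (domination_number (graph_complement (noncyclic_graph G))) = int n - 1
        \<longleftrightarrow> G \<cong> sym_group 3) \<and>
     (int (domination_number (noncyclic_graph G)) +
      int (domination_number (graph_complement (noncyclic_graph G))) = int n - 2
        \<longleftrightarrow> G \<cong> dihedral_group 4) \<and>
     (int (domination_number (noncyclic_graph G)) +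
      int (domination_number (graph_complement (noncyclic_graph G))) = int n - 3
        \<longleftrightarrow> G \<cong> dihedral_group 5 \<or>
            G \<cong> integer_mod_group 3 \<times>\<times> integer_mod_group 3)"
proof -
  interpret group G by fact
  interpret finite_group G by unfold_locales fact
  have "\<one>\<^bsub>G\<^esub> \<in> cyclicizer G"
  proof -
    have "cocyclic x \<one>\<^bsub>G\<^esub>" if "x \<in> carrier G" for x
      using cocyclic_mem[OF that cyc_one] .
    then show ?thesis by (simp add: cyclicizer_def cyclic_pair_cocyclic)
  qed
  then have cyclicizer: "cyclicizer G = {\<one>\<^bsub>G\<^esub>}"
    using \<open>card (cyclicizer G) = 1\<close> by (metis card_1_singletonE singletonD)
  have "carrier G \<noteq> {\<one>\<^bsub>G\<^esub>}"
  proof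
    assume triv: "carrier G = {\<one>\<^bsub>G\<^esub>}"
    have "trivial_group (subgroup_generated G S)" for S
      using trivial_group_subgroup_generated_eq triv by simp
    then show False
      using \<open>\<not> locally_cyclic G\<close> trivial_imp_cyclic_group by (auto simp: locally_cyclic_def)
  qed
  then interpret trivial_cyclicizer_group G by unfold_locales (rule cyclicizer)
  \<comment> \<open>\<open>S\<^sub>3\<close> is the dihedral group of order six and so falls under the dihedral case.\<close>
  have S3: "G \<cong> sym_group 3 \<longleftrightarrow> G \<cong> dihedral_group 3"
    using iso_trans[OF _ sym_group_3_iso_dihedral_group]
      iso_trans[OF _ group.iso_sym[OF sym_group_is_group sym_group_3_iso_dihedral_group]]
    by (rule iffI)
  have n: "order G = n" by fact
  let ?s = "int \<gamma> + int \<gamma>'"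
  have el: "elementary_abelian_group 2 G \<Longrightarrow> ?s = int n"
    using elementary_abelian_2_sum n by linarith
  have d3: "G \<cong> dihedral_group 3 \<Longrightarrow> ?s = int n - 1"
    using dihedral_group_sum[of 3] n by simp
  have d4: "G \<cong> dihedral_group 4 \<Longrightarrow> ?s = int n - 2"
    using dihedral_group_sum[of 4] n by simp
  have d5: "G \<cong> dihedral_group 5 \<Longrightarrow> ?s = int n - 3"
    using dihedral_group_sum[of 5] n by simp
  have z3: "G \<cong> integer_mod_group 3 \<times>\<times> integer_mod_group 3 \<Longrightarrow> ?s = int n - 3"
    using Z3_Z3_sum n by linarith
  have "elementary_abelian_group 2 G \<or> G \<cong> dihedral_group 3 \<or> G \<cong> dihedral_group 4 \<or>
      G \<cong> dihedral_group 5 \<or> G \<cong> integer_mod_group 3 \<times>\<times> integer_mod_group 3"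
    if "?s \<ge> int n - 3"
    using large_sum_cases that n by linarith
  then show ?thesis
    unfolding S3 using el d3 d4 d5 z3 by (intro conjI iffI) auto
qed

end
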